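(* Let $k\ge 1$ and let $n_1,\dots,n_k\ge 1$ be integers. Then, as $N\to\infty$, $$\mathbb{E}_N\left[\frac{1}{N}\sum_{n=1}^N Z^{(n_1)}(\theta_n)\cdots Z^{(n_k)}(\theta_n)\right]\sim(-1)^{n_1+\cdots+n_k-k}\,i^{\,n_1+\cdots+n_k}\,\frac{n_1!\cdots n_k!}{(n_1+\cdots+n_k+1)!}\,N^{n_1+\cdots+n_k},$$ where $Z^{(n)}(\theta)$ denotes the $n$-th derivative of $Z(\theta)$ with respect to $\theta$, and $\sim$ means that the ratio of the two sides tends to $1$.
   Context: For an $N\times N$ unitary matrix with eigenvalues $e^{i\theta_1},\dots,e^{i\theta_N}$, the characteristic polynomial is $Z(\theta)=\prod_{m=1}^N\left(1-e^{i\theta_m}e^{-i\theta}\right)$. $\mathbb{E}_N$ denotes expectation over Haar measure on the $N\times N$ unitary group; in terms of the eigenphases $(\theta_1,\dots,\theta_N)\in[-\pi,\pi)^N$ this is integration against the Weyl density $\frac{1}{N!(2\pi)^N}\prod_{1\le j<\ell\le N}|e^{i\theta_j}-e^{i\theta_\ell}|^2\,d\theta_1\cdots d\theta_N$. *)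

theory Defs
  imports "HOL-Probability.Probability" "HOL-Library.Landau_Symbols"
begin

text \<open>Eigenphases of an \<open>N \<times> N\<close> unitary matrix are given by a function \<open>\<phi> :: nat \<Rightarrow> real\<close>,
  of which only the values on \<open>{1..N}\<close> matter; \<open>cis x\<close> is \<open>exp (\<i> x)\<close>.\<close>

definition charpoly_Z :: "nat \<Rightarrow> (nat \<Rightarrow> real) \<Rightarrow> real \<Rightarrow> complex" where
  "charpoly_Z N \<phi> t = (\<Prod>m=1..N. 1 - cis (\<phi> m) * cis (- t))"

text \<open>The iterated derivative of a complex-valued function of a real variable; the
  library's \<open>deriv\<close> only covers functions from a field to itself.\<close>

definition nth_deriv :: "nat \<Rightarrow> (real \<Rightarrow> complex) \<Rightarrow> real \<Rightarrow> complex" where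
  "nth_deriv n f = ((\<lambda>g t. vector_derivative g (at t)) ^^ n) f"

definition weyl_density :: "nat \<Rightarrow> (nat \<Rightarrow> real) \<Rightarrow> real" where
  "weyl_density N \<phi> =
     1 / (fact N * (2 * pi) ^ N) * (\<Prod>l=1..N. \<Prod>j=1..<l. (cmod (cis (\<phi> j) - cis (\<phi> l)))\<^sup>2)"

text \<open>The joint law of the eigenphases in \<open>[-\<pi>, \<pi>)\<^sup>N\<close> of a Haar-distributed unitary matrix
  (Weyl's integration formula). Haar measure enters only through this law: expectations of
  symmetric functions of the eigenphases are integrals with respect to it.\<close>

definition eigenphase_measure :: "nat \<Rightarrow> (nat \<Rightarrow> real) measure" where
  "eigenphase_measure N =
     density (\<Pi>\<^sub>M m\<in>{1..N}. restrict_space lborel {-pi..<pi}) (\<lambda>\<phi>. ennreal (weyl_density N \<phi>))"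

end

(* Proof idea. Write z_m = cis (phi m). By symmetry it suffices to evaluate the derivatives at phi N.
   Splitting off the factor of Z that vanishes there, Z^(n)(phi N) equals
     -(-i)^n * sum_s (-1)^s ((s+1)^n - s^n) e_s(z_1, ..., z_(N-1)) z_N^(-s),
   with e_s the elementary symmetric polynomials. The Weyl density is |W|^2 / (N! (2 pi)^N) for the
   Vandermonde product W. Expanding conj W by Leibniz' formula, the expectation becomes a signed sum,
   over p < N, of the coefficients in W * (product of the derivatives) of the monomial carrying the
   exponent p on z_N and the exponents {0, ..., N-1} - {p} on the other variables. Multiplication by
   (-1)^s e_s z_N^(-s) merely moves the missing exponent p up by s, by antisymmetry in z_1, ..., z_(N-1).
   Hence the expectation is exactly
     (prod_j -(-i)^(n_j)) / N * sum over p + s_1 + ... + s_k <= N-1 of prod_j ((s_j+1)^(n_j) - s_j^(n_j)),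
   an iterated convolution, whose growth follows by comparing each factor with a multiple of a binomial
   coefficient: those convolve exactly, by the Chu-Vandermonde identity. *)

theory Submission
  imports Defs "HOL-Real_Asymp.Real_Asymp"
begin

section \<open>Alternants and the Vandermonde product\<close>

text \<open>The determinant with entries \<open>x m ^ (j - 1)\<close>, in Leibniz form because its
  single monomials are needed later. Each \<open>\<sigma> m\<close> is at least 1, so the
  subtraction never truncates.\<close>

definition alternant :: "nat \<Rightarrow> (nat \<Rightarrow> complex) \<Rightarrow> complex" where
  "alternant N x = (\<Sum>\<sigma> | \<sigma> permutes {1..N}. of_int (sign \<sigma>) * (\<Prod>m=1..N. x m ^ (\<sigma> m - 1)))"

text \<open>Replacing the summation index \<sigma> by \<sigma> \<circ> \<tau> splits off the sign of
  \<tau> and merely reindexes the product over \<open>m\<close>.\<close>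

lemma alternant_permute:
  assumes \<tau>: "\<tau> permutes {1..N}"
  shows "alternant N (x \<circ> \<tau>) = of_int (sign \<tau>) * alternant N x"
proof -
  have "alternant N (x \<circ> \<tau>) =
      (\<Sum>\<sigma> | \<sigma> permutes {1..N}. of_int (sign (\<sigma> \<circ> \<tau>)) * (\<Prod>m=1..N. x (\<tau> m) ^ ((\<sigma> \<circ> \<tau>) m - 1)))"
    unfolding alternant_def
    by (subst sum_permutations_compose_right[OF \<tau>]) (simp add: o_def)
  also have "\<dots> = (\<Sum>\<sigma> | \<sigma> permutes {1..N}. of_int (sign \<tau>) * (of_int (sign \<sigma>) * (\<Prod>m=1..N. x m ^ (\<sigma> m - 1))))"
  proof (rule sum.cong[OF refl], clarify)
    fix \<sigma> assume \<sigma>: "\<sigma> permutes {1..N}"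
    have "(\<Prod>m=1..N. x (\<tau> m) ^ ((\<sigma> \<circ> \<tau>) m - 1)) = (\<Prod>m=1..N. x m ^ (\<sigma> m - 1))"
      using prod.permute[OF \<tau>, of "\<lambda>m. x m ^ (\<sigma> m - 1)"] by (simp add: o_def)
    moreover have "sign (\<sigma> \<circ> \<tau>) = sign \<sigma> * sign \<tau>"
      using \<sigma> \<tau> by (intro sign_compose) (auto intro: permutation_permutes[THEN iffD2])
    ultimately show "of_int (sign (\<sigma> \<circ> \<tau>)) * (\<Prod>m=1..N. x (\<tau> m) ^ ((\<sigma> \<circ> \<tau>) m - 1)) =
      of_int (sign \<tau>) * (of_int (sign \<sigma>) * (\<Prod>m=1..N. x m ^ (\<sigma> m - 1)))"
      by simp
  qed
  finally show ?thesis
    unfolding alternant_def by (simp add: sum_distrib_left)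
qed

text \<open>Exchanging \<open>i\<close> and \<open>j\<close> fixes \<open>x\<close> and yet changes
  the sign.\<close>

lemma alternant_eq_0:
  assumes "i \<in> {1..N}" "j \<in> {1..N}" "i \<noteq> j" "x i = x j"
  shows "alternant N x = 0"
proof -
  have "x \<circ> Transposition.transpose i j = x"
    using assms by (auto simp: fun_eq_iff Transposition.transpose_def)
  moreover have "alternant N (x \<circ> Transposition.transpose i j) = - alternant N x"
    using assms by (subst alternant_permute) (auto intro: permutes_swap_id simp: sign_swap_id)
  ultimately show ?thesis
    by simp
qed

text \<open>Induction on \<open>N\<close>, reading both sides for \<open>Suc N\<close> as
  polynomials in the last variable: of degree at most \<open>N\<close>, both zero at the earlier
  nodes, and with the same coefficient of degree \<open>N\<close>.\<close>

lemma vandermonde_alternant: "(\<Prod>l=1..N. \<Prod>j=1..<l. x l - x j) = alternant N x"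
proof (induction N)
  case 0
  show ?case by (simp add: alternant_def)
next
  case (Suc N)
  let ?S = "{\<sigma>. \<sigma> permutes {1..Suc N}}"
  have step: "(\<Prod>l=1..Suc N. \<Prod>j=1..<l. x l - x j) = alternant N x * (\<Prod>j=1..<Suc N. x (Suc N) - x j)"
    unfolding Suc.IH[symmetric] by (rule prod.nat_ivl_Suc'[THEN trans]) auto
  have fin: "finite ?S" by (simp add: finite_permutations)
  show ?case
  proof (cases "inj_on x {1..N}")
    \<comment> \<open>With a repeated node there are too few interpolation points, but then both
      sides vanish.\<close>
    case False
    then obtain i j where ij: "i \<in> {1..N}" "j \<in> {1..N}" "i \<noteq> j" "x i = x j"
      by (auto simp: inj_on_def)
    then have "alternant N x = 0" "alternant (Suc N) x = 0"
      by (auto intro!: alternant_eq_0[of i _ j])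
    then show ?thesis
      by (simp only: step mult_zero_left)
  next
    case True
    \<comment> \<open>The alternant with its last variable made an indeterminate.\<close>
    define p where "p = (\<Sum>\<sigma>\<in>?S. smult (of_int (sign \<sigma>) * (\<Prod>m=1..N. x m ^ (\<sigma> m - 1))) (monom 1 (\<sigma> (Suc N) - 1)))"
    define q where "q = smult (alternant N x) (\<Prod>j=1..N. [:- x j, 1:])"
    have poly_p: "poly p y = alternant (Suc N) (x(Suc N := y))" for y
      unfolding p_def alternant_def poly_sum
      by (rule sum.cong) (auto simp: poly_monom)
    have deg_prod: "degree (\<Prod>j=1..N. [:- x j, 1:]) = N"
      by (subst degree_prod_sum_eq) auto
    have "p = q"
    proof (rule poly_eqI_degree_lead_coeff[where n = N and A = "x ` {1..N}"])
      show "card (x ` {1..N}) \<ge> N"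
        using True by (simp add: card_image)
      show "degree p \<le> N"
        unfolding p_def
      proof (intro degree_sum_le fin)
        fix \<sigma> assume "\<sigma> \<in> ?S"
        then have "\<sigma> (Suc N) \<in> {1..Suc N}"
          by (subst permutes_in_image[of _ "{1..Suc N}"]) auto
        then show "degree (smult (of_int (sign \<sigma>) * (\<Prod>m=1..N. x m ^ (\<sigma> m - 1))) (monom 1 (\<sigma> (Suc N) - 1))) \<le> N"
          by (intro order.trans[OF degree_smult_le] order.trans[OF degree_monom_le]) auto
      qed
      show "degree q \<le> N"
        unfolding q_def using deg_prod by (metis degree_smult_le)
      show "poly p z = poly q z" if "z \<in> x ` {1..N}" for z
      proof -
        obtain j where j: "j \<in> {1..N}" "z = x j"
          using \<open>z \<in> x ` {1..N}\<close> by auto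
        have "poly p z = 0"
          unfolding poly_p j using j by (intro alternant_eq_0[where i = j and j = "Suc N"]) auto
        moreover have "poly q z = 0"
          using j by (auto simp: q_def poly_prod)
        ultimately show ?thesis by simp
      qed
      have "coeff (\<Prod>j=1..N. [:- x j, 1:]) N = 1"
        using lead_coeff_prod[of "\<lambda>j. [:- x j, 1:]" "{1..N}"] deg_prod by simp
      then have "coeff q N = alternant N x"
        by (simp add: q_def)
      moreover have "coeff p N = alternant N x"
      proof -
        \<comment> \<open>Degree \<open>N\<close> forces \<open>\<sigma> (Suc N) = Suc N\<close>,
          and such \<sigma> are exactly the permutations of \<open>{1..N}\<close>.\<close>
        have "coeff p N = (\<Sum>\<sigma>\<in>?S. if \<sigma> (Suc N) = Suc N then of_int (sign \<sigma>) * (\<Prod>m=1..N. x m ^ (\<sigma> m - 1)) else 0)"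
          unfolding p_def coeff_sum
        proof (rule sum.cong[OF refl])
          fix \<sigma> assume "\<sigma> \<in> ?S"
          then have "\<sigma> (Suc N) \<in> {1..Suc N}"
            by (subst permutes_in_image[of _ "{1..Suc N}"]) auto
          then have "\<sigma> (Suc N) - 1 = N \<longleftrightarrow> \<sigma> (Suc N) = Suc N"
            by auto
          then show "coeff (smult (of_int (sign \<sigma>) * (\<Prod>m=1..N. x m ^ (\<sigma> m - 1))) (monom 1 (\<sigma> (Suc N) - 1))) N =
             (if \<sigma> (Suc N) = Suc N then of_int (sign \<sigma>) * (\<Prod>m=1..N. x m ^ (\<sigma> m - 1)) else 0)"
            by simp
        qed
        also have "\<dots> = (\<Sum>\<sigma> | \<sigma> \<in> ?S \<and> \<sigma> (Suc N) = Suc N. of_int (sign \<sigma>) * (\<Prod>m=1..N. x m ^ (\<sigma> m - 1)))"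
          by (rule sum.inter_filter[OF fin, symmetric])
        also have "{\<sigma>. \<sigma> \<in> ?S \<and> \<sigma> (Suc N) = Suc N} = {\<sigma>. \<sigma> permutes {1..N}}"
        proof (intro set_eqI iffI; clarify)
          fix \<sigma> assume \<sigma>: "\<sigma> permutes {1..Suc N}" "\<sigma> (Suc N) = Suc N"
          show "\<sigma> permutes {1..N}"
            by (rule permutes_superset[OF \<sigma>(1)]) (use \<sigma>(2) in \<open>auto simp: le_Suc_eq\<close>)
        next
          fix \<sigma> assume \<sigma>: "\<sigma> permutes {1..N}"
          show "\<sigma> \<in> ?S \<and> \<sigma> (Suc N) = Suc N"
            using permutes_subset[OF \<sigma>] permutes_not_in[OF \<sigma>, of "Suc N"] by auto
        qed
        finally show ?thesis
          by (simp add: alternant_def)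
      qed
      ultimately show "coeff p N = coeff q N" by simp
    qed
    then have "alternant (Suc N) x = poly q (x (Suc N))"
      using poly_p[of "x (Suc N)"] by simp
    also have "\<dots> = alternant N x * (\<Prod>j=1..N. x (Suc N) - x j)"
      by (simp add: q_def poly_prod)
    also have "{1..N} = {1..<Suc N}"
      by auto
    finally show ?thesis
      by (simp only: step mult_zero_left)
  qed
qed

section \<open>Fourier coefficients on the torus\<close>

text \<open>The reference measure of \<open>eigenphase_measure\<close>, without the Weyl density.
  Its total mass is \<open>(2 * pi) ^ N\<close>, which \<open>tcoeff\<close> divides out.\<close>

definition torus :: "nat \<Rightarrow> (nat \<Rightarrow> real) measure" where
  "torus N = (\<Pi>\<^sub>M m\<in>{1..N}. restrict_space lborel {-pi..<pi})"

text \<open>A Laurent monomial in the variables \<open>cis (\<phi> m)\<close>; the exponents are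
  integers because negative powers of the last variable will occur.\<close>

definition tmono :: "nat \<Rightarrow> (nat \<Rightarrow> int) \<Rightarrow> (nat \<Rightarrow> real) \<Rightarrow> complex" where
  "tmono N \<alpha> \<phi> = (\<Prod>m=1..N. cis (of_int (\<alpha> m) * \<phi> m))"

text \<open>The coefficient of the Laurent monomial \<open>\<Prod>m. cis (\<phi> m) powi \<alpha> m\<close>, read off as a Fourier
  coefficient. Only the values of \<open>\<alpha>\<close> on \<open>{1..N}\<close> matter.\<close>

definition tcoeff :: "nat \<Rightarrow> (nat \<Rightarrow> int) \<Rightarrow> ((nat \<Rightarrow> real) \<Rightarrow> complex) \<Rightarrow> complex" where
  "tcoeff N \<alpha> F = (\<integral>\<phi>. F \<phi> * tmono N (- \<alpha>) \<phi> \<partial>torus N) / of_real ((2 * pi) ^ N)"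

text \<open>Boundedness with measurability is stable under products, unlike integrability, and
  implies integrability on the finite measure \<open>torus N\<close>. The bound is asked for every
  \<phi>, on the torus or not, so that bounds combine pointwise.\<close>

definition bmeas :: "nat \<Rightarrow> ((nat \<Rightarrow> real) \<Rightarrow> complex) \<Rightarrow> bool" where
  "bmeas N F \<longleftrightarrow> F \<in> borel_measurable (torus N) \<and> (\<exists>K. \<forall>\<phi>. cmod (F \<phi>) \<le> K)"

section \<open>Finiteness of the torus measure and closure properties of bounded measurable
  functions\<close>

lemma finite_measure_arc: "finite_measure (restrict_space lborel {-pi..<pi})"
  by (rule finite_measureI) (simp add: space_restrict_space emeasure_restrict_space)

lemma product_sigma_finite_arc: "product_sigma_finite (\<lambda>_. restrict_space lborel {-pi..<pi})"
  using finite_measure_arc finite_measure.axioms(1)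
  by (intro product_sigma_finite.intro) 

lemma finite_measure_torus: "finite_measure (torus N)"
proof -
  interpret product_sigma_finite "\<lambda>_::nat. restrict_space lborel {-pi..<pi}"
    by (rule product_sigma_finite_arc)
  show ?thesis
  proof (rule finite_measureI)
    have "emeasure (torus N) (space (torus N)) =
        (\<Prod>m=1..N. emeasure (restrict_space lborel {-pi..<pi}) (space (restrict_space lborel {-pi..<pi})))"
      unfolding torus_def space_PiM by (intro emeasure_PiM sets.top) simp
    then show "emeasure (torus N) (space (torus N)) \<noteq> \<infinity>"
      by (simp add: space_restrict_space emeasure_restrict_space power_eq_top_ennreal)
  qed
qed

lemma measurable_torus_component:
  "m \<in> {1..N} \<Longrightarrow> (\<lambda>\<phi>. \<phi> m) \<in> borel_measurable (torus N)"
proof -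
  assume "m \<in> {1..N}"
  then have "(\<lambda>\<phi>. \<phi> m) \<in> torus N \<rightarrow>\<^sub>M restrict_space lborel {-pi..<pi}"
    unfolding torus_def by (rule measurable_component_singleton)
  moreover have "(\<lambda>x. x) \<in> restrict_space lborel {-pi..<pi} \<rightarrow>\<^sub>M borel"
    by (intro measurable_restrict_space1) simp
  ultimately show ?thesis
    by (rule measurable_compose)
qed

lemma measurable_cis [measurable]: "cis \<in> borel_measurable borel"
  by (intro borel_measurable_continuous_onI continuous_intros)

lemma measurable_cis_component:
  "m \<in> {1..N} \<Longrightarrow> (\<lambda>\<phi>. cis (c * \<phi> m)) \<in> borel_measurable (torus N)"
proof -
  assume m: "m \<in> {1..N}"
  have "(\<lambda>x. cis (c * x)) \<in> borel_measurable borel"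
    by measurable
  then show ?thesis
    by (rule measurable_compose[OF measurable_torus_component[OF m]])
qed

lemma bmeas_integrable: "bmeas N F \<Longrightarrow> integrable (torus N) F"
  unfolding bmeas_def
  by (auto intro!: finite_measure.integrable_const_bound[OF finite_measure_torus] AE_I2)

lemma bmeas_const: "bmeas N (\<lambda>_. c)"
  by (auto simp: bmeas_def)

lemma bmeas_cis: "m \<in> {1..N} \<Longrightarrow> bmeas N (\<lambda>\<phi>. cis (c * \<phi> m))"
  using measurable_cis_component by (auto simp: bmeas_def intro!: exI[of _ 1])

lemma bmeas_add:
  assumes "bmeas N F" "bmeas N G"
  shows "bmeas N (\<lambda>\<phi>. F \<phi> + G \<phi>)"
proof -
  from assms obtain K L where "\<And>\<phi>. cmod (F \<phi>) \<le> K" "\<And>\<phi>. cmod (G \<phi>) \<le> L"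
    by (auto simp: bmeas_def)
  then have "cmod (F \<phi> + G \<phi>) \<le> K + L" for \<phi>
    by (meson add_mono norm_triangle_mono)
  with assms show ?thesis
    by (auto simp: bmeas_def)
qed

lemma bmeas_mult:
  assumes "bmeas N F" "bmeas N G"
  shows "bmeas N (\<lambda>\<phi>. F \<phi> * G \<phi>)"
proof -
  from assms obtain K L where "\<And>\<phi>. cmod (F \<phi>) \<le> K" "\<And>\<phi>. cmod (G \<phi>) \<le> L"
    by (auto simp: bmeas_def)
  then have "cmod (F \<phi> * G \<phi>) \<le> K * L" for \<phi>
    unfolding norm_mult by (meson mult_mono norm_ge_zero order.trans)
  with assms show ?thesis
    by (auto simp: bmeas_def)
qed

lemma bmeas_sum: "(\<And>i. i \<in> A \<Longrightarrow> bmeas N (F i)) \<Longrightarrow> bmeas N (\<lambda>\<phi>. \<Sum>i\<in>A. F i \<phi>)"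
  by (induction A rule: infinite_finite_induct) (auto intro: bmeas_const bmeas_add)

lemma bmeas_prod: "(\<And>i. i \<in> A \<Longrightarrow> bmeas N (F i)) \<Longrightarrow> bmeas N (\<lambda>\<phi>. \<Prod>i\<in>A. F i \<phi>)"
  by (induction A rule: infinite_finite_induct) (auto intro: bmeas_const bmeas_mult)

lemma bmeas_tmono: "bmeas N (tmono N \<alpha>)"
  unfolding tmono_def [abs_def] by (intro bmeas_prod bmeas_cis)

lemmas bmeas_intros = bmeas_const bmeas_cis bmeas_add bmeas_mult bmeas_sum bmeas_prod bmeas_tmono

section \<open>Orthogonality of Laurent monomials\<close>

lemma tmono_add: "tmono N (\<lambda>m. \<alpha> m + \<beta> m) \<phi> = tmono N \<alpha> \<phi> * tmono N \<beta> \<phi>"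
  by (simp add: tmono_def cis_mult prod.distrib [symmetric] algebra_simps)

lemma tmono_permute:
  assumes \<tau>: "\<tau> permutes {1..N}"
  shows "tmono N (\<alpha> \<circ> \<tau>) (\<phi> \<circ> \<tau>) = tmono N \<alpha> \<phi>"
  using prod.permute[OF \<tau>, of "\<lambda>m. cis (of_int (\<alpha> m) * \<phi> m)"] by (simp add: tmono_def o_def)

text \<open>For nonzero \<open>a\<close> the antiderivative takes equal values at both ends, where
  the phases differ by an integer multiple of the period.\<close>

lemma integral_cis_arc:
  "(\<integral>x. cis (of_int a * x) \<partial>restrict_space lborel {-pi..<pi}) = (if a = 0 then of_real (2 * pi) else 0)"
proof -
  have meas: "(\<lambda>x. indicator A x *\<^sub>R cis (of_int a * x)) \<in> borel_measurable lborel" if "A \<in> sets borel" for A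
    using that by (intro borel_measurable_scaleR borel_measurable_indicator)
      (auto intro!: borel_measurable_continuous_onI continuous_intros)
  have "(\<integral>x. cis (of_int a * x) \<partial>restrict_space lborel {-pi..<pi}) =
      (\<integral>x. indicator {-pi..<pi} x *\<^sub>R cis (of_int a * x) \<partial>lborel)"
    by (subst integral_restrict_space) auto
  \<comment> \<open>The fundamental theorem of calculus needs the closed interval; the added
    endpoint is a null set.\<close>
  also have "\<dots> = (\<integral>x. indicator {-pi..pi} x *\<^sub>R cis (of_int a * x) \<partial>lborel)"
  proof (rule integral_cong_AE)
    have "AE x in lborel. x \<noteq> pi"
      by (rule AE_lborel_singleton)
    then show "AE x in lborel. indicator {-pi..<pi} x *\<^sub>R cis (of_int a * x) = indicator {-pi..pi} x *\<^sub>R cis (of_int a * x)"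
      by eventually_elim (auto simp: indicator_def)
  qed (simp_all add: meas)
  also have "\<dots> = (if a = 0 then of_real (2 * pi) else 0)"
  proof (cases "a = 0")
    case True
    then show ?thesis by (simp add: scaleR_conv_of_real)
  next
    case False
    define f where "f = (\<lambda>x. cis (of_int a * x) / (\<i> * of_int a))"
    have "(f has_vector_derivative cis (of_int a * x)) (at x within {-pi..pi})" for x
      unfolding f_def cis_conv_exp using False
      by (auto intro!: derivative_eq_intros has_vector_derivative_real_field simp: field_simps)
    then have "(\<integral>x. indicator {-pi..pi} x *\<^sub>R cis (of_int a * x) \<partial>lborel) = f pi - f (-pi)"
      by (intro integral_FTC_atLeastAtMost) (auto intro!: continuous_intros)
    also have "cis (of_int a * pi) = cis (- (of_int a * pi)) * cis (2 * pi * of_int a)"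
      by (subst cis_mult) (simp add: algebra_simps)
    then have "cis (of_int a * pi) = cis (- (of_int a * pi))"
      by simp
    then have "f pi - f (-pi) = 0"
      by (simp add: f_def)
    finally show ?thesis
      using False by simp
  qed
  finally show ?thesis .
qed

text \<open>The integrand is a product of functions of single coordinates, so the integral
  factors.\<close>

lemma integral_tmono:
  "(\<integral>\<phi>. tmono N \<alpha> \<phi> \<partial>torus N) = (if \<forall>m\<in>{1..N}. \<alpha> m = 0 then of_real ((2 * pi) ^ N) else 0)"
proof -
  interpret product_sigma_finite "\<lambda>_::nat. restrict_space lborel {-pi..<pi}"
    by (rule product_sigma_finite_arc)
  have "integrable (restrict_space lborel {-pi..<pi}) (\<lambda>x. cis (c * x))" for c
    by (intro finite_measure.integrable_const_bound[OF finite_measure_arc, of _ 1] AE_I2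
        measurable_restrict_space1) (auto intro!: borel_measurable_continuous_onI continuous_intros)
  then have "(\<integral>\<phi>. tmono N \<alpha> \<phi> \<partial>torus N) = (\<Prod>m=1..N. if \<alpha> m = 0 then of_real (2 * pi) else 0)"
    unfolding tmono_def torus_def
    by (subst product_integral_prod[where f = "\<lambda>m x. cis (of_int (\<alpha> m) * x)"]) (simp_all only: finite_atLeastAtMost integral_cis_arc)
  also have "\<dots> = (if \<forall>m\<in>{1..N}. \<alpha> m = 0 then of_real ((2 * pi) ^ N) else 0)"
    by (cases "\<forall>m\<in>{1..N}. \<alpha> m = 0") auto
  finally show ?thesis .
qed

lemma tcoeff_tmono: "tcoeff N \<alpha> (tmono N \<beta>) = (if \<forall>m\<in>{1..N}. \<alpha> m = \<beta> m then 1 else 0)"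
proof -
  have "tcoeff N \<alpha> (tmono N \<beta>) = (\<integral>\<phi>. tmono N (\<lambda>m. \<beta> m + (- \<alpha>) m) \<phi> \<partial>torus N) / of_real ((2 * pi) ^ N)"
    unfolding tcoeff_def tmono_add ..
  then show ?thesis
    by (auto simp: integral_tmono)
qed

lemma tcoeff_shift: "tcoeff N \<alpha> (\<lambda>\<phi>. F \<phi> * tmono N \<beta> \<phi>) = tcoeff N (\<alpha> - \<beta>) F"
proof -
  have "- (\<alpha> - \<beta>) = (\<lambda>m. \<beta> m + (- \<alpha>) m)"
    by (auto simp: fun_eq_iff)
  then show ?thesis
    unfolding tcoeff_def by (simp only: tmono_add mult.assoc)
qed

lemma tcoeff_cong: "(\<And>m. m \<in> {1..N} \<Longrightarrow> \<alpha> m = \<beta> m) \<Longrightarrow> tcoeff N \<alpha> F = tcoeff N \<beta> F"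
  unfolding tcoeff_def tmono_def by simp

lemma tcoeff_sum:
  assumes "\<And>i. i \<in> A \<Longrightarrow> bmeas N (F i)"
  shows "tcoeff N \<alpha> (\<lambda>\<phi>. \<Sum>i\<in>A. F i \<phi>) = (\<Sum>i\<in>A. tcoeff N \<alpha> (F i))"
  unfolding tcoeff_def sum_distrib_right sum_divide_distrib [symmetric]
  by (subst Bochner_Integration.integral_sum) (auto intro!: bmeas_integrable bmeas_mult bmeas_tmono assms)

lemma tcoeff_cmult: "tcoeff N \<alpha> (\<lambda>\<phi>. c * F \<phi>) = c * tcoeff N \<alpha> F"
  unfolding tcoeff_def by (simp add: mult.assoc)

section \<open>Invariance of the torus measure under permutation of coordinates\<close>

lemma measurable_torus_permute:
  assumes \<tau>: "\<tau> permutes {1..N}"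
  shows "(\<lambda>\<phi>. \<phi> \<circ> \<tau>) \<in> torus N \<rightarrow>\<^sub>M torus N"
proof -
  have "(\<lambda>\<phi> m. \<phi> (\<tau> m)) \<in> torus N \<rightarrow>\<^sub>M torus N"
    unfolding torus_def
  proof (rule measurable_PiM_single')
    show "(\<lambda>\<phi>. \<phi> (\<tau> m)) \<in> (\<Pi>\<^sub>M m\<in>{1..N}. restrict_space lborel {-pi..<pi}) \<rightarrow>\<^sub>M restrict_space lborel {-pi..<pi}"
      if "m \<in> {1..N}" for m
      using that permutes_in_image[OF \<tau>] by (intro measurable_component_singleton) simp
    show "(\<lambda>\<phi> m. \<phi> (\<tau> m)) \<in> space (\<Pi>\<^sub>M m\<in>{1..N}. restrict_space lborel {-pi..<pi}) \<rightarrow>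
        (\<Pi>\<^sub>E m\<in>{1..N}. space (restrict_space lborel {-pi..<pi}))"
    proof (rule funcsetI)
      fix \<phi> assume "\<phi> \<in> space (\<Pi>\<^sub>M m\<in>{1..N}. restrict_space lborel {-pi..<pi})"
      then have \<phi>: "\<phi> \<in> (\<Pi>\<^sub>E m\<in>{1..N}. space (restrict_space lborel {-pi..<pi}))"
        by (simp only: space_PiM)
      show "(\<lambda>m. \<phi> (\<tau> m)) \<in> (\<Pi>\<^sub>E m\<in>{1..N}. space (restrict_space lborel {-pi..<pi}))"
      proof (rule PiE_I)
        show "\<phi> (\<tau> m) \<in> space (restrict_space lborel {-pi..<pi})" if "m \<in> {1..N}" for m
          using that permutes_in_image[OF \<tau>] by (intro PiE_mem[OF \<phi>]) simp
        \<comment> \<open>Points of the product space are \<open>undefined\<close> off the index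
          set, and \<tau> fixes every index there.\<close>
        show "\<phi> (\<tau> m) = undefined" if "m \<notin> {1..N}" for m
          using that permutes_not_in[OF \<tau>] by (auto intro: PiE_arb[OF \<phi>])
      qed
    qed
  qed
  then show ?thesis
    by (simp add: o_def)
qed

text \<open>All factors of the product measure are the same. The preimage of a box is the box with
  its sides permuted, which has equal measure, and boxes determine the product measure.\<close>

lemma distr_torus_permute:
  assumes \<tau>: "\<tau> permutes {1..N}"
  shows "distr (torus N) (torus N) (\<lambda>\<phi>. \<phi> \<circ> \<tau>) = torus N"
proof -
  interpret product_sigma_finite "\<lambda>_::nat. restrict_space lborel {-pi..<pi}"
    by (rule product_sigma_finite_arc)
  note m = measurable_torus_permute[OF \<tau>]
  let ?C = "restrict_space lborel {-pi..<pi} :: real measure"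
  show ?thesis
    unfolding torus_def
  proof (rule PiM_eqI)
    fix A :: "nat \<Rightarrow> real set" assume A: "\<And>i. i \<in> {1..N} \<Longrightarrow> A i \<in> sets ?C"
    have inv: "inv \<tau> permutes {1..N}"
      using \<tau> by (rule permutes_inv)
    have sub: "A i \<subseteq> space ?C" if "i \<in> {1..N}" for i
      using A[OF that] by (rule sets.sets_into_space)
    have eq: "(\<lambda>\<phi>. \<phi> \<circ> \<tau>) -` Pi\<^sub>E {1..N} A \<inter> space (PiM {1..N} (\<lambda>_. ?C)) = Pi\<^sub>E {1..N} (A \<circ> inv \<tau>)"
    proof (intro set_eqI iffI)
      fix \<phi> assume *: "\<phi> \<in> (\<lambda>\<phi>. \<phi> \<circ> \<tau>) -` Pi\<^sub>E {1..N} A \<inter> space (PiM {1..N} (\<lambda>_. ?C))"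
      show "\<phi> \<in> Pi\<^sub>E {1..N} (A \<circ> inv \<tau>)"
      proof (rule PiE_I)
        fix i assume "i \<in> {1..N}"
        then have "inv \<tau> i \<in> {1..N}"
          using permutes_in_image[OF inv] by simp
        with * have "(\<phi> \<circ> \<tau>) (inv \<tau> i) \<in> A (inv \<tau> i)"
          by (auto dest: PiE_mem)
        then show "\<phi> i \<in> (A \<circ> inv \<tau>) i"
          using permutes_inverses(1)[OF \<tau>] by simp
      next
        fix i assume "i \<notin> {1..N}"
        with * PiE_arb[of \<phi> "{1..N}"] show "\<phi> i = undefined"
          unfolding space_PiM by blast
      qed
    next
      fix \<phi> assume *: "\<phi> \<in> Pi\<^sub>E {1..N} (A \<circ> inv \<tau>)"
      have in_A: "\<phi> (\<tau> i) \<in> A i" if "i \<in> {1..N}" for i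
        using PiE_mem[OF *, of "\<tau> i"] that permutes_in_image[OF \<tau>] permutes_inverses(2)[OF \<tau>] by simp
      have in_C: "\<phi> i \<in> space ?C" if "i \<in> {1..N}" for i
        using in_A[of "inv \<tau> i"] sub[of "inv \<tau> i"] that permutes_in_image[OF inv] permutes_inverses(1)[OF \<tau>]
        by auto
      have undef: "\<phi> i = undefined" if "i \<notin> {1..N}" for i
        using PiE_arb[OF * that] .
      show "\<phi> \<in> (\<lambda>\<phi>. \<phi> \<circ> \<tau>) -` Pi\<^sub>E {1..N} A \<inter> space (PiM {1..N} (\<lambda>_. ?C))"
        unfolding space_PiM using in_A in_C undef permutes_not_in[OF \<tau>]
        by (auto intro!: PiE_I simp del: atLeastAtMost_iff)
    qed
    have "emeasure (distr (PiM {1..N} (\<lambda>_. ?C)) (PiM {1..N} (\<lambda>_. ?C)) (\<lambda>\<phi>. \<phi> \<circ> \<tau>)) (Pi\<^sub>E {1..N} A) =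
        emeasure (PiM {1..N} (\<lambda>_. ?C)) (Pi\<^sub>E {1..N} (A \<circ> inv \<tau>))"
      using A by (subst emeasure_distr) (auto intro!: sets_PiM_I_finite m[unfolded torus_def] simp only: eq finite_atLeastAtMost)
    also have "\<dots> = (\<Prod>i\<in>{1..N}. emeasure ?C ((A \<circ> inv \<tau>) i))"
      using A permutes_in_image[OF inv] by (intro emeasure_PiM) auto
    also have "\<dots> = (\<Prod>i\<in>{1..N}. emeasure ?C (A i))"
      using prod.permute[OF inv, of "\<lambda>i. emeasure ?C (A i)"] by (simp add: o_def)
    finally show "emeasure (distr (PiM {1..N} (\<lambda>_. ?C)) (PiM {1..N} (\<lambda>_. ?C)) (\<lambda>\<phi>. \<phi> \<circ> \<tau>)) (Pi\<^sub>E {1..N} A) =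
        (\<Prod>i\<in>{1..N}. emeasure ?C (A i))" .
  qed simp_all
qed

lemma integral_torus_permute:
  assumes \<tau>: "\<tau> permutes {1..N}" and F: "bmeas N F"
  shows "(\<integral>\<phi>. F (\<phi> \<circ> \<tau>) \<partial>torus N) = (\<integral>\<phi>. F \<phi> \<partial>torus N)"
proof -
  have "(\<integral>\<phi>. F \<phi> \<partial>torus N) = (\<integral>\<phi>. F \<phi> \<partial>distr (torus N) (torus N) (\<lambda>\<phi>. \<phi> \<circ> \<tau>))"
    by (simp only: distr_torus_permute[OF \<tau>])
  also have "\<dots> = (\<integral>\<phi>. F (\<phi> \<circ> \<tau>) \<partial>torus N)"
    using F by (intro integral_distr measurable_torus_permute \<tau>) (auto simp: bmeas_def)
  finally show ?thesis ..
qed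

text \<open>Permuting variables and exponents together leaves a monomial unchanged, so the change of
  variables passes to the exponents.\<close>

lemma tcoeff_permute:
  assumes \<tau>: "\<tau> permutes {1..N}" and F: "bmeas N F"
  shows "tcoeff N \<alpha> (\<lambda>\<phi>. F (\<phi> \<circ> \<tau>)) = tcoeff N (\<alpha> \<circ> \<tau>) F"
proof -
  have "- (\<alpha> \<circ> \<tau>) = (- \<alpha>) \<circ> \<tau>"
    by (simp add: fun_eq_iff)
  then have "(\<integral>\<phi>. F (\<phi> \<circ> \<tau>) * tmono N (- \<alpha>) \<phi> \<partial>torus N) =
      (\<integral>\<phi>. F (\<phi> \<circ> \<tau>) * tmono N (- (\<alpha> \<circ> \<tau>)) (\<phi> \<circ> \<tau>) \<partial>torus N)"
    by (simp only: tmono_permute[OF \<tau>])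
  also have "\<dots> = (\<integral>\<phi>. F \<phi> * tmono N (- (\<alpha> \<circ> \<tau>)) \<phi> \<partial>torus N)"
    by (intro integral_torus_permute[OF \<tau>] bmeas_intros F)
  finally show ?thesis
    unfolding tcoeff_def by simp
qed

section \<open>Asymptotics of iterated convolutions\<close>

text \<open>With \<open>D\<^sub>j(x) = (\<Sum>s. d j s * x^s)\<close>, this is the coefficient of \<open>x^r\<close> in
  \<open>D\<^sub>1(x) \<cdots> D\<^sub>k(x) / (1 - x)\<close>.\<close>

fun iter_conv :: "(nat \<Rightarrow> nat \<Rightarrow> 'a::comm_semiring_1) \<Rightarrow> nat \<Rightarrow> nat \<Rightarrow> 'a" where
  "iter_conv d 0 r = 1"
| "iter_conv d (Suc k) r = (\<Sum>s\<le>r. d (Suc k) s * iter_conv d k (r - s))"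

lemma iter_conv_cmult:
  "iter_conv (\<lambda>j s. c j * d j s) k r = (\<Prod>j=1..k. c j) * iter_conv d k r"
  by (induction k arbitrary: r) (simp_all add: sum_distrib_left mult_ac)

lemma iter_conv_of_real:
  "iter_conv (\<lambda>j s. of_real (d j s)) k r = (of_real (iter_conv d k r) :: complex)"
  by (induction k arbitrary: r) simp_all

text \<open>Chu-Vandermonde: the coefficient of x^r in (1-x)^-(a+1) times (1-x)^-(b+1). The proof is
  by induction on \<open>b\<close> and, inside it, on \<open>r\<close>.\<close>

lemma sum_choose_conv:
  "(\<Sum>s\<le>r. ((s + a) choose a) * ((r - s + b) choose b)) = (r + a + b + 1) choose (a + b + 1)"
proof (induction b arbitrary: r)
  case 0
  show ?case
    using choose_rising_sum(1)[of a r] by (simp add: add_ac)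
next
  case (Suc b)
  note IH_b = Suc
  show ?case
  proof (induction r)
    case 0
    show ?case by simp
  next
    case (Suc r)
    have "(\<Sum>s\<le>Suc r. ((s + a) choose a) * ((Suc r - s + Suc b) choose Suc b)) =
        (\<Sum>s\<le>r. ((s + a) choose a) * ((Suc r - s + Suc b) choose Suc b)) + ((Suc r + a) choose a)"
      by simp
    \<comment> \<open>Pascal's rule on the second binomial coefficient.\<close>
    also have "(\<Sum>s\<le>r. ((s + a) choose a) * ((Suc r - s + Suc b) choose Suc b)) =
        (\<Sum>s\<le>r. ((s + a) choose a) * ((r - s + Suc b) choose Suc b)) +
        (\<Sum>s\<le>r. ((s + a) choose a) * ((Suc r - s + b) choose b))"
      unfolding sum.distrib [symmetric] by (intro sum.cong refl) (simp add: Suc_diff_le algebra_simps)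
    \<comment> \<open>The term \<open>s = Suc r\<close> split off above completes the second sum to
      an instance of the hypothesis for \<open>b\<close>.\<close>
    also have "\<dots> + ((Suc r + a) choose a) =
        (\<Sum>s\<le>r. ((s + a) choose a) * ((r - s + Suc b) choose Suc b)) +
        (\<Sum>s\<le>Suc r. ((s + a) choose a) * ((Suc r - s + b) choose b))"
      by simp
    finally show ?case
      unfolding Suc.IH IH_b by simp
  qed
qed

text \<open>The coefficient of x^r in (1-x)^-(a+1), a polynomial in \<open>r\<close> of degree
  \<open>a\<close>. As a scale of growth it improves on r^a: it convolves exactly and never
  vanishes.\<close>

definition mchoose :: "nat \<Rightarrow> nat \<Rightarrow> real" where
  "mchoose a r = of_nat ((r + a) choose a)"

lemma mchoose_pos: "mchoose a r > 0"
  by (simp add: mchoose_def)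

lemma mchoose_mono: "r \<le> r' \<Longrightarrow> mchoose a r \<le> mchoose a r'"
  unfolding mchoose_def by (intro of_nat_mono binomial_right_mono) simp

lemma mchoose_conv: "(\<Sum>s\<le>r. mchoose a s * mchoose b (r - s)) = mchoose (a + b + 1) r"
  unfolding mchoose_def of_nat_mult [symmetric] of_nat_sum [symmetric] sum_choose_conv
  by (simp add: add_ac)

text \<open>By the absorption identity, passing from \<open>a\<close> to \<open>Suc a\<close>
  multiplies by (r + a + 1) / (a + 1).\<close>

lemma mchoose_power_limit: "(\<lambda>r. mchoose a r / real r ^ a) \<longlonglongrightarrow> 1 / fact a"
proof (induction a)
  case 0
  show ?case by (simp add: mchoose_def)
next
  case (Suc a)
  have "mchoose (Suc a) r = mchoose a r * (real r + real (Suc a)) / real (Suc a)" for r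
  proof -
    have "Suc a * ((r + Suc a) choose Suc a) = Suc (r + a) * ((r + a) choose a)"
      using Suc_times_binomial[of a "r + a"] by simp
    then have "real (Suc a * ((r + Suc a) choose Suc a)) = real (Suc (r + a) * ((r + a) choose a))"
      by (simp only:)
    then have "real (Suc a) * mchoose (Suc a) r = (real r + real (Suc a)) * mchoose a r"
      unfolding mchoose_def of_nat_mult by simp
    then show ?thesis
      by (simp add: field_simps)
  qed
  then have eq: "mchoose (Suc a) r / real r ^ Suc a =
      (mchoose a r / real r ^ a) * ((real r + real (Suc a)) / real r) / real (Suc a)" for r
    by simp
  have "(\<lambda>r. (real r + real (Suc a)) / real r) \<longlonglongrightarrow> 1"
    by real_asymp
  from tendsto_divide[OF tendsto_mult[OF Suc this] tendsto_const[of "real (Suc a)"]]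
  show ?case
    unfolding eq by (simp add: field_simps)
qed

lemma mchoose_ratio_limit:
  assumes "b < a"
  shows "(\<lambda>r. mchoose b r / mchoose a r) \<longlonglongrightarrow> 0"
proof -
  have "(\<lambda>r. (mchoose b r / real r ^ b) / (mchoose a r / real r ^ a) * (1 / real r ^ (a - b)))
      \<longlonglongrightarrow> (1 / fact b) / (1 / fact a) * 0"
    using assms by (intro tendsto_mult tendsto_divide mchoose_power_limit) (simp, real_asymp)
  moreover have "eventually (\<lambda>r. (mchoose b r / real r ^ b) / (mchoose a r / real r ^ a) * (1 / real r ^ (a - b)) =
      mchoose b r / mchoose a r) sequentially"
    using eventually_gt_at_top[of 0]
  proof eventually_elim
    case (elim r)
    then show ?case
      using assms mchoose_pos[of a r] by (simp add: field_simps power_add [symmetric])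
  qed
  ultimately show ?thesis
    by (simp add: tendsto_cong)
qed

text \<open>The sum is split at an index \<open>S\<close> past which \<open>u\<close> is small
  against \<open>mchoose a\<close>. The early terms are finitely many and
  O(\<open>mchoose b r\<close>), hence of lower order; the late ones are bounded by the exact
  convolution \<open>mchoose_conv\<close>.\<close>

lemma conv_limit_0:
  assumes u: "(\<lambda>r. u r / mchoose a r) \<longlonglongrightarrow> 0" and v: "\<And>r. \<bar>v r\<bar> \<le> K * mchoose b r"
  shows "(\<lambda>r. (\<Sum>s\<le>r. u s * v (r - s)) / mchoose (a + b + 1) r) \<longlonglongrightarrow> 0"
proof (rule tendstoI)
  fix e :: real assume "e > 0"
  have "K \<ge> 0"
    using v[of 0] by (simp add: mchoose_def)
  \<comment> \<open>Chosen to give \<open>h * K < e / 2\<close>; \<open>K + 1\<close> keeps the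
    denominator positive when \<open>K = 0\<close>.\<close>
  define h where "h = e / (2 * (K + 1))"
  have "h > 0"
    using \<open>e > 0\<close> \<open>K \<ge> 0\<close> by (simp add: h_def)
  have "h * K < e / 2"
    using \<open>e > 0\<close> \<open>K \<ge> 0\<close> by (simp add: h_def field_simps)
  from tendstoD[OF u \<open>h > 0\<close>] obtain S where "\<And>r. r \<ge> S \<Longrightarrow> \<bar>u r / mchoose a r\<bar> < h"
    by (auto simp: eventually_sequentially)
  then have S: "\<bar>u r\<bar> \<le> h * mchoose a r" if "r \<ge> S" for r
    using that mchoose_pos[of a r] by (fastforce simp: abs_divide field_simps)
  define D where "D = (\<Sum>s<S. \<bar>u s\<bar>) * K"
  have bound: "\<bar>\<Sum>s\<le>r. u s * v (r - s)\<bar> \<le> D * mchoose b r + h * K * mchoose (a + b + 1) r" for r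
  proof -
    have "\<bar>u s * v (r - s)\<bar> \<le> (if s < S then \<bar>u s\<bar> * K * mchoose b r else 0) + h * K * (mchoose a s * mchoose b (r - s))"
      for s
    proof (cases "s < S")
      case True
      have "\<bar>u s\<bar> * \<bar>v (r - s)\<bar> \<le> \<bar>u s\<bar> * (K * mchoose b r)"
        using v[of "r - s"] mchoose_mono[of "r - s" r b] \<open>K \<ge> 0\<close>
        by (intro mult_left_mono) (auto intro: order.trans mult_left_mono)
      moreover have "0 \<le> h * K * (mchoose a s * mchoose b (r - s))"
        using \<open>h > 0\<close> \<open>K \<ge> 0\<close> by (simp add: mchoose_def)
      ultimately show ?thesis
        using True by (simp add: abs_mult mult.assoc)
    next
      case False
      then have "\<bar>u s\<bar> * \<bar>v (r - s)\<bar> \<le> (h * mchoose a s) * (K * mchoose b (r - s))"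
        using \<open>h > 0\<close> by (intro mult_mono S v) (auto simp: mchoose_def)
      then show ?thesis
        using False by (simp add: abs_mult mult_ac)
    qed
    then have "\<bar>\<Sum>s\<le>r. u s * v (r - s)\<bar> \<le>
        (\<Sum>s\<le>r. (if s < S then \<bar>u s\<bar> * K * mchoose b r else 0) + h * K * (mchoose a s * mchoose b (r - s)))"
      by (intro order.trans[OF sum_abs] sum_mono)
    also have "\<dots> = (\<Sum>s\<le>r. if s < S then \<bar>u s\<bar> * K * mchoose b r else 0) + h * K * mchoose (a + b + 1) r"
      by (simp only: sum.distrib sum_distrib_left [symmetric] mchoose_conv)
    also have "(\<Sum>s\<le>r. if s < S then \<bar>u s\<bar> * K * mchoose b r else 0) =
        (\<Sum>s | s \<le> r \<and> s < S. \<bar>u s\<bar> * K * mchoose b r)"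
      by (subst sum.inter_filter [symmetric]) auto
    also have "\<dots> \<le> (\<Sum>s<S. \<bar>u s\<bar> * K * mchoose b r)"
      using \<open>K \<ge> 0\<close> by (intro sum_mono2) (auto simp: mchoose_def)
    also have "\<dots> = D * mchoose b r"
      by (simp add: D_def sum_distrib_right)
    finally show ?thesis by simp
  qed
  have "(\<lambda>r. D * (mchoose b r / mchoose (a + b + 1) r)) \<longlonglongrightarrow> D * 0"
    by (intro tendsto_intros mchoose_ratio_limit) simp
  then have "eventually (\<lambda>r. D * (mchoose b r / mchoose (a + b + 1) r) < e / 2) sequentially"
    using \<open>e > 0\<close> by (intro order_tendstoD(2)[where y = "D * 0"]) auto
  then show "eventually (\<lambda>r. dist ((\<Sum>s\<le>r. u s * v (r - s)) / mchoose (a + b + 1) r) 0 < e) sequentially"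
  proof eventually_elim
    case (elim r)
    have "\<bar>\<Sum>s\<le>r. u s * v (r - s)\<bar> / mchoose (a + b + 1) r \<le> (D * mchoose b r + h * K * mchoose (a + b + 1) r) / mchoose (a + b + 1) r"
      using bound mchoose_pos by (intro divide_right_mono) (auto intro: less_imp_le)
    also have "\<dots> = D * (mchoose b r / mchoose (a + b + 1) r) + h * K"
      using mchoose_pos[of "a + b + 1" r] by (simp add: field_simps)
    also have "\<dots> < e"
      using elim \<open>h * K < e / 2\<close> by linarith
    finally show ?case
      using mchoose_pos[of "a + b + 1" r] by (simp add: abs_divide)
  qed
qed

text \<open>Subtract from \<open>u\<close> and \<open>v\<close> the multiples of
  \<open>mchoose\<close> that they approach. The main parts convolve exactly to
  \<open>x * y * mchoose (a + b + 1) r\<close>, and the two error convolutions fall to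
  \<open>conv_limit_0\<close>.\<close>

lemma conv_limit:
  assumes u: "(\<lambda>r. u r / mchoose a r) \<longlonglongrightarrow> x" and v: "(\<lambda>r. v r / mchoose b r) \<longlonglongrightarrow> y"
  shows "(\<lambda>r. (\<Sum>s\<le>r. u s * v (r - s)) / mchoose (a + b + 1) r) \<longlonglongrightarrow> x * y"
proof -
  note pos = mchoose_pos[THEN less_imp_neq, THEN not_sym]
  define u' where "u' r = u r - x * mchoose a r" for r
  define v' where "v' r = v r - y * mchoose b r" for r
  obtain K where K0: "\<forall>r. norm (v r / mchoose b r) \<le> K"
    using convergent_imp_Bseq[OF convergentI[OF v]] unfolding Bseq_def by blast
  have "\<bar>v r\<bar> / mchoose b r \<le> K" for r
    using K0[THEN spec, of r] mchoose_pos[of b r] by (simp add: abs_divide)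
  then have K: "\<bar>v r\<bar> \<le> K * mchoose b r" for r
    using mchoose_pos[of b r] by (metis pos_divide_le_eq)
  have "(\<lambda>r. u r / mchoose a r - x) \<longlonglongrightarrow> 0"
    using u by (simp add: LIM_zero_iff)
  then have "(\<lambda>r. u' r / mchoose a r) \<longlonglongrightarrow> 0"
    using pos by (simp add: u'_def diff_divide_distrib)
  from conv_limit_0[OF this K]
  have 1: "(\<lambda>r. (\<Sum>s\<le>r. u' s * v (r - s)) / mchoose (a + b + 1) r) \<longlonglongrightarrow> 0" .
  have "(\<lambda>r. v r / mchoose b r - y) \<longlonglongrightarrow> 0"
    using v by (simp add: LIM_zero_iff)
  then have "(\<lambda>r. v' r / mchoose b r) \<longlonglongrightarrow> 0"
    using pos by (simp add: v'_def diff_divide_distrib)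
  \<comment> \<open>The roles are exchanged here: \<open>v'\<close> is the small sequence, and the
    multiple of \<open>mchoose a\<close> the bounded one.\<close>
  from conv_limit_0[OF this, of "\<lambda>r. x * mchoose a r" "\<bar>x\<bar>" a]
  have 2: "(\<lambda>r. (\<Sum>s\<le>r. v' s * (x * mchoose a (r - s))) / mchoose (a + b + 1) r) \<longlonglongrightarrow> 0"
    using mchoose_pos[THEN less_imp_le] by (simp add: abs_mult add.commute)
  have "(\<Sum>s\<le>r. u s * v (r - s)) = (\<Sum>s\<le>r. u' s * v (r - s)) + (\<Sum>s\<le>r. v' s * (x * mchoose a (r - s))) +
      x * y * mchoose (a + b + 1) r" for r
  proof -
    have "(\<Sum>s\<le>r. v' s * (x * mchoose a (r - s))) = (\<Sum>s\<le>r. v' (r - s) * (x * mchoose a s))"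
      by (rule sum.reindex_bij_witness[where i = "\<lambda>s. r - s" and j = "\<lambda>s. r - s"]) auto
    then show ?thesis
      unfolding mchoose_conv [symmetric] sum_distrib_left
      by (simp add: u'_def v'_def sum.distrib [symmetric] algebra_simps)
  qed
  then have "(\<Sum>s\<le>r. u s * v (r - s)) / mchoose (a + b + 1) r =
      (\<Sum>s\<le>r. u' s * v (r - s)) / mchoose (a + b + 1) r +
      (\<Sum>s\<le>r. v' s * (x * mchoose a (r - s))) / mchoose (a + b + 1) r + x * y" for r
    using pos[of "a + b + 1" r] by (simp add: add_divide_distrib)
  then show ?thesis
    using tendsto_add[OF tendsto_add[OF 1 2] tendsto_const[of "x * y"]] by simp
qed

text \<open>The increment is a sum of \<open>n\<close> terms, each asymptotic to s^(n-1), while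
  \<open>mchoose (n - 1) s\<close> is asymptotic to s^(n-1) / (n-1)!; the quotient tends to n *
  (n-1)!.\<close>

lemma power_increment_limit:
  assumes "n \<ge> 1"
  shows "(\<lambda>s. ((real s + 1) ^ n - real s ^ n) / mchoose (n - 1) s) \<longlonglongrightarrow> fact n"
proof -
  have "(\<lambda>s. (\<Sum>i<n. ((real s + 1) / real s) ^ i)) \<longlonglongrightarrow> (\<Sum>i<n. 1 ^ i)"
    by (intro tendsto_sum tendsto_power) real_asymp
  moreover have "eventually (\<lambda>s. (\<Sum>i<n. ((real s + 1) / real s) ^ i) =
      ((real s + 1) ^ n - real s ^ n) / real s ^ (n - 1)) sequentially"
    using eventually_gt_at_top[of 0]
  proof eventually_elim
    case (elim s)
    have "(real s + 1) ^ n - real s ^ n = (\<Sum>i<n. real s ^ (n - Suc i) * (real s + 1) ^ i)"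
      by (subst power_diff_sumr2) simp
    also have "\<dots> = (\<Sum>i<n. ((real s + 1) / real s) ^ i * real s ^ (n - 1))"
    proof (rule sum.cong[OF refl])
      fix i assume "i \<in> {..<n}"
      then have "real s ^ (n - 1) = real s ^ (n - Suc i) * real s ^ i"
        by (simp add: power_add [symmetric])
      then show "real s ^ (n - Suc i) * (real s + 1) ^ i = ((real s + 1) / real s) ^ i * real s ^ (n - 1)"
        using elim by (simp add: power_divide)
    qed
    finally show ?case
      using elim by (simp add: sum_distrib_right [symmetric])
  qed
  ultimately have "(\<lambda>s. ((real s + 1) ^ n - real s ^ n) / real s ^ (n - 1)) \<longlonglongrightarrow> real n"
    by (simp add: tendsto_cong)
  then have "(\<lambda>s. (((real s + 1) ^ n - real s ^ n) / real s ^ (n - 1)) / (mchoose (n - 1) s / real s ^ (n - 1)))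
      \<longlonglongrightarrow> real n / (1 / fact (n - 1))"
    by (intro tendsto_divide mchoose_power_limit) auto
  also have "real n / (1 / fact (n - 1)) = fact n"
    using assms by (simp add: fact_reduce)
  finally show ?thesis
  proof (rule Lim_transform_eventually)
    show "eventually (\<lambda>s. (((real s + 1) ^ n - real s ^ n) / real s ^ (n - 1)) / (mchoose (n - 1) s / real s ^ (n - 1)) =
        ((real s + 1) ^ n - real s ^ n) / mchoose (n - 1) s) sequentially"
      using eventually_gt_at_top[of 0] by eventually_elim simp
  qed
qed

text \<open>The factor \<open>j\<close> has order \<open>n j - 1\<close> and each convolution adds
  one, so the orders accumulate to the sum of the \<open>n j\<close>.\<close>

lemma iter_conv_limit:
  assumes "\<And>j. j \<in> {1..k} \<Longrightarrow> n j \<ge> 1"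
  shows "(\<lambda>r. iter_conv (\<lambda>j s. (real s + 1) ^ n j - real s ^ n j) k r / mchoose (\<Sum>j=1..k. n j) r)
      \<longlonglongrightarrow> (\<Prod>j=1..k. fact (n j))"
  using assms
proof (induction k)
  case 0
  show ?case by (simp add: mchoose_def)
next
  case (Suc k)
  have "n (Suc k) \<ge> 1"
    using Suc.prems by auto
  then have "(n (Suc k) - 1) + (\<Sum>j=1..k. n j) + 1 = (\<Sum>j=1..Suc k. n j)"
    by simp
  with conv_limit[OF power_increment_limit[OF \<open>n (Suc k) \<ge> 1\<close>] Suc.IH] Suc.prems show ?case
    by (simp add: mult.commute)
qed

text \<open>Summation is convolution with the constant sequence \<open>mchoose 0\<close>, which
  raises the order by one. The binomial scale is then traded for powers, and this produces the
  factorial in the denominator.\<close>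

lemma sum_iter_conv_limit:
  assumes "\<And>j. j \<in> {1..k} \<Longrightarrow> n j \<ge> 1"
  shows "(\<lambda>N. (\<Sum>r<N. iter_conv (\<lambda>j s. (real s + 1) ^ n j - real s ^ n j) k r) / real N ^ ((\<Sum>j=1..k. n j) + 1))
      \<longlonglongrightarrow> (\<Prod>j=1..k. fact (n j)) / fact ((\<Sum>j=1..k. n j) + 1)"
proof -
  define f where "f = iter_conv (\<lambda>j s. (real s + 1) ^ n j - real s ^ n j) k"
  define m where "m = (\<Sum>j=1..k. n j)"
  have "(\<lambda>r. 1 / mchoose 0 r) \<longlonglongrightarrow> 1"
    by (simp add: mchoose_def)
  from conv_limit[OF this iter_conv_limit[of k n, OF assms]]
  have 1: "(\<lambda>r. (\<Sum>s\<le>r. f (r - s)) / mchoose (m + 1) r) \<longlonglongrightarrow> (\<Prod>j=1..k. fact (n j))"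
    by (simp add: f_def m_def)
  \<comment> \<open>The last factor moves the scale from \<open>r\<close> to
    \<open>N = Suc r\<close>, the number of terms in the sum.\<close>
  have "(\<lambda>r. ((\<Sum>s\<le>r. f (r - s)) / mchoose (m + 1) r) * (mchoose (m + 1) r / real r ^ (m + 1)) * (real r / real (Suc r)) ^ (m + 1))
      \<longlonglongrightarrow> (\<Prod>j=1..k. fact (n j)) * (1 / fact (m + 1)) * 1 ^ (m + 1)"
    by (intro tendsto_mult 1 mchoose_power_limit tendsto_power) real_asymp
  moreover have "eventually (\<lambda>r. ((\<Sum>s\<le>r. f (r - s)) / mchoose (m + 1) r) * (mchoose (m + 1) r / real r ^ (m + 1)) * (real r / real (Suc r)) ^ (m + 1) =
     (\<Sum>r<Suc r. f r) / real (Suc r) ^ (m + 1)) sequentially"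
    using eventually_gt_at_top[of 0]
  proof eventually_elim
    case (elim r)
    have "(\<Sum>s\<le>r. f (r - s)) = (\<Sum>r<Suc r. f r)"
      by (rule sum.reindex_bij_witness[where i = "\<lambda>s. r - s" and j = "\<lambda>s. r - s"]) auto
    then show ?case
      using elim mchoose_pos[of "m + 1" r] by (simp only: power_divide) simp
  qed
  ultimately have "(\<lambda>r. (\<Sum>r<Suc r. f r) / real (Suc r) ^ (m + 1)) \<longlonglongrightarrow> (\<Prod>j=1..k. fact (n j)) / fact (m + 1)"
    by (simp add: tendsto_cong del: sum.lessThan_Suc of_nat_Suc)
  then show ?thesis
    unfolding f_def [symmetric] m_def [symmetric]
    by (subst (asm) filterlim_sequentially_Suc[where f = "\<lambda>N. (\<Sum>r<N. f r) / real N ^ (m + 1)"])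
qed

section \<open>The Pieri rule for the Weyl alternant\<close>

definition weyl_alternant :: "nat \<Rightarrow> (nat \<Rightarrow> real) \<Rightarrow> complex" where
  "weyl_alternant N \<phi> = alternant N (\<lambda>m. cis (\<phi> m))"

lemma weyl_alternant_eq:
  "weyl_alternant N \<phi> = (\<Sum>\<sigma> | \<sigma> permutes {1..N}. of_int (sign \<sigma>) * tmono N (\<lambda>m. int (\<sigma> m) - 1) \<phi>)"
  unfolding weyl_alternant_def alternant_def tmono_def
proof (intro sum.cong[OF refl] arg_cong2[where f = "(*)"] prod.cong[OF refl] refl, clarify)
  fix \<sigma> m assume "\<sigma> permutes {1..N}" "m \<in> {1..N}"
  then have "\<sigma> m \<in> {1..N}"
    using permutes_in_image[of \<sigma> "{1..N}" m] by simp
  then show "cis (\<phi> m) ^ (\<sigma> m - 1) = cis (of_int (int (\<sigma> m) - 1) * \<phi> m)"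
    by (simp add: Complex.DeMoivre of_nat_diff)
qed

lemma weyl_alternant_permute:
  assumes "\<tau> permutes {1..N}"
  shows "weyl_alternant N (\<phi> \<circ> \<tau>) = of_int (sign \<tau>) * weyl_alternant N \<phi>"
  using alternant_permute[OF assms, of "\<lambda>m. cis (\<phi> m)"] by (simp add: weyl_alternant_def o_def)

lemma bmeas_weyl_alternant: "bmeas N (weyl_alternant N)"
  unfolding weyl_alternant_eq [abs_def] by (intro bmeas_intros)

lemma tcoeff_weyl_alternant:
  "tcoeff N \<alpha> (weyl_alternant N) =
     (\<Sum>\<sigma> | \<sigma> permutes {1..N}. of_int (sign \<sigma>) * (if \<forall>m\<in>{1..N}. \<alpha> m = int (\<sigma> m) - 1 then 1 else 0))"
  unfolding weyl_alternant_eq [abs_def]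
  by (subst tcoeff_sum) (auto intro!: bmeas_intros simp only: tcoeff_cmult tcoeff_tmono)

text \<open>Off \<open>{1..N}\<close> every competing permutation is the identity, so the exponents
  determine the permutation and a single Leibniz term survives.\<close>

lemma tcoeff_weyl_alternant_permutation:
  assumes c: "c permutes {1..N}" and \<alpha>: "\<And>m. m \<in> {1..N} \<Longrightarrow> \<alpha> m = int (c m) - 1"
  shows "tcoeff N \<alpha> (weyl_alternant N) = of_int (sign c)"
proof -
  have "(\<forall>m\<in>{1..N}. \<alpha> m = int (\<sigma> m) - 1) \<longleftrightarrow> \<sigma> = c" if \<sigma>: "\<sigma> permutes {1..N}" for \<sigma>
  proof
    assume *: "\<forall>m\<in>{1..N}. \<alpha> m = int (\<sigma> m) - 1"
    have "\<sigma> m = c m" for m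
      using * \<alpha>[of m] permutes_not_in[OF c, of m] permutes_not_in[OF \<sigma>, of m]
      by (cases "m \<in> {1..N}") (auto simp del: atLeastAtMost_iff)
    then show "\<sigma> = c" by blast
  qed (use \<alpha> in blast)
  then have "tcoeff N \<alpha> (weyl_alternant N) = (\<Sum>\<sigma> | \<sigma> permutes {1..N}. if \<sigma> = c then of_int (sign \<sigma>) else 0)"
    unfolding tcoeff_weyl_alternant by (intro sum.cong) auto
  also have "\<dots> = of_int (sign c)"
    using c by (simp add: finite_permutations)
  finally show ?thesis .
qed

text \<open>Antisymmetric in the first \<open>N - 1\<close> variables and polynomial (no negative exponents) in them;
  the last variable, at which the derivatives are evaluated, is unconstrained.\<close>

definition admissible :: "nat \<Rightarrow> ((nat \<Rightarrow> real) \<Rightarrow> complex) \<Rightarrow> bool" where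
  "admissible N F \<longleftrightarrow> bmeas N F \<and>
     (\<forall>\<tau> \<phi>. \<tau> permutes {1..N-1} \<longrightarrow> F (\<phi> \<circ> \<tau>) = of_int (sign \<tau>) * F \<phi>) \<and>
     (\<forall>\<alpha>. (\<exists>m\<in>{1..N-1}. \<alpha> m < 0) \<longrightarrow> tcoeff N \<alpha> F = 0)"

lemma admissible_vanish:
  "admissible N F \<Longrightarrow> m \<in> {1..N-1} \<Longrightarrow> \<alpha> m < 0 \<Longrightarrow> tcoeff N \<alpha> F = 0"
  unfolding admissible_def by blast

lemma permutes_pred: "\<tau> permutes {1..N-1} \<Longrightarrow> \<tau> permutes {1..N::nat}"
  by (erule permutes_subset) auto

text \<open>Its exponents \<open>\<sigma> m - 1\<close> are never negative, and it is antisymmetric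
  even in all \<open>N\<close> variables.\<close>

lemma admissible_weyl_alternant: "admissible N (weyl_alternant N)"
  unfolding admissible_def
proof (intro conjI allI impI)
  fix \<alpha> :: "nat \<Rightarrow> int" assume "\<exists>m\<in>{1..N-1}. \<alpha> m < 0"
  then obtain m where "m \<in> {1..N-1}" and neg: "\<alpha> m < 0"
    by blast
  then have m: "m \<in> {1..N}" "\<alpha> m < 0"
    by auto
  have "\<not> (\<forall>m\<in>{1..N}. \<alpha> m = int (\<sigma> m) - 1)" if "\<sigma> permutes {1..N}" for \<sigma>
  proof
    assume "\<forall>m\<in>{1..N}. \<alpha> m = int (\<sigma> m) - 1"
    then have "\<alpha> m = int (\<sigma> m) - 1" using m(1) ..
    then show False
      using permutes_in_image[OF that, of m] m by auto
  qed
  then show "tcoeff N \<alpha> (weyl_alternant N) = 0"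
    unfolding tcoeff_weyl_alternant
    by (intro sum.neutral ballI) (simp only: mem_Collect_eq if_False mult_zero_right)
qed (simp_all only: bmeas_weyl_alternant weyl_alternant_permute permutes_pred)

lemma tcoeff_antisym:
  assumes F: "admissible N F" and \<tau>: "\<tau> permutes {1..N-1}"
  shows "tcoeff N (\<alpha> \<circ> \<tau>) F = of_int (sign \<tau>) * tcoeff N \<alpha> F"
proof -
  have bF: "bmeas N F" and anti: "\<And>\<phi>. F (\<phi> \<circ> \<tau>) = of_int (sign \<tau>) * F \<phi>"
    using F \<tau> unfolding admissible_def by blast+
  have "tcoeff N (\<alpha> \<circ> \<tau>) F = tcoeff N \<alpha> (\<lambda>\<phi>. F (\<phi> \<circ> \<tau>))"
    by (rule tcoeff_permute [OF permutes_pred[OF \<tau>] bF, symmetric])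
  also have "(\<lambda>\<phi>. F (\<phi> \<circ> \<tau>)) = (\<lambda>\<phi>. of_int (sign \<tau>) * F \<phi>)"
    by (rule ext) (rule anti)
  finally show ?thesis
    by (simp only: tcoeff_cmult)
qed

text \<open>Exchanging the two variables fixes the exponents but negates the coefficient.\<close>

lemma tcoeff_antisym_eq_0:
  assumes F: "admissible N F" and ij: "i \<in> {1..N-1}" "j \<in> {1..N-1}" "i \<noteq> j" "\<alpha> i = \<alpha> j"
  shows "tcoeff N \<alpha> F = 0"
proof -
  have "\<alpha> \<circ> Transposition.transpose i j = \<alpha>"
    using ij by (auto simp: fun_eq_iff Transposition.transpose_def)
  moreover have "tcoeff N (\<alpha> \<circ> Transposition.transpose i j) F = - tcoeff N \<alpha> F"
    using ij by (subst tcoeff_antisym[OF F]) (auto intro: permutes_swap_id simp: sign_swap_id)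
  ultimately show ?thesis
    by simp
qed

section \<open>Multiplication by weighted elementary symmetric polynomials\<close>

text \<open>For \<open>S\<close> inside \<open>{1..N-1}\<close>, the exponents of the product over
  \<open>S\<close> of \<open>cis (\<phi> m - \<phi> N)\<close>. In the language of Pieri's rule
  \<open>S\<close> is a vertical strip, which \<open>tcoeff_shift\<close> takes off.\<close>

definition strip_vec :: "nat \<Rightarrow> nat set \<Rightarrow> nat \<Rightarrow> int" where
  "strip_vec N S m = (if m = N then - int (card S) else if m \<in> S then 1 else 0)"

text \<open>With z_m = \<open>cis (\<phi> m)\<close>, this is the sum over s of (-1)^s d(s) e_s(z_1,
  ..., z_(N-1)) z_N^(-s). The weights \<open>d\<close> stay free so as to cover derivatives of every
  order.\<close>

definition esym_factor :: "nat \<Rightarrow> (nat \<Rightarrow> complex) \<Rightarrow> (nat \<Rightarrow> real) \<Rightarrow> complex" where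
  "esym_factor N d \<phi> = (\<Sum>S\<in>Pow {1..N-1}. (- 1) ^ card S * d (card S) * (\<Prod>m\<in>S. cis (\<phi> m - \<phi> N)))"

lemma tmono_strip_vec:
  assumes S: "S \<subseteq> {1..N-1}"
  shows "tmono N (strip_vec N S) \<phi> = (\<Prod>m\<in>S. cis (\<phi> m - \<phi> N))"
proof (cases "N = 0")
  case True
  then show ?thesis using S by (simp add: tmono_def)
next
  case False
  have fin: "finite S" using S by (rule finite_subset) simp
  have ins: "{1..N} = insert N {1..N-1}" using False by auto
  have "tmono N (strip_vec N S) \<phi> =
      cis (- (of_nat (card S) * \<phi> N)) * (\<Prod>m\<in>{1..N-1}. cis (of_int (strip_vec N S m) * \<phi> m))"
    unfolding tmono_def ins using False by (subst prod.insert) (auto simp: strip_vec_def)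
  also have "(\<Prod>m\<in>{1..N-1}. cis (of_int (strip_vec N S m) * \<phi> m)) = (\<Prod>m\<in>S. cis (of_int (strip_vec N S m) * \<phi> m))"
    using S by (intro prod.mono_neutral_right) (auto simp: strip_vec_def)
  also have "\<dots> = (\<Prod>m\<in>S. cis (\<phi> m))"
    using S False by (intro prod.cong) (auto simp: strip_vec_def)
  also have "cis (- (of_nat (card S) * \<phi> N)) = (\<Prod>m\<in>S. cis (- \<phi> N))"
    using Complex.DeMoivre[of "- \<phi> N" "card S"] by simp
  finally show ?thesis
    unfolding prod.distrib [symmetric] cis_mult by simp
qed

lemma esym_factor_eq:
  "esym_factor N d \<phi> = (\<Sum>S\<in>Pow {1..N-1}. (- 1) ^ card S * d (card S) * tmono N (strip_vec N S) \<phi>)"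
  unfolding esym_factor_def by (intro sum.cong) (simp_all add: tmono_strip_vec)

lemma bmeas_esym_factor: "bmeas N (esym_factor N d)"
  unfolding esym_factor_eq [abs_def] by (intro bmeas_intros)

text \<open>\<tau> fixes \<open>N\<close> and permutes the subsets of \<open>{1..N-1}\<close> of
  each size.\<close>

lemma esym_factor_permute:
  assumes \<tau>: "\<tau> permutes {1..N-1}"
  shows "esym_factor N d (\<phi> \<circ> \<tau>) = esym_factor N d \<phi>"
proof -
  have N: "\<tau> N = N"
    using \<tau> by (rule permutes_not_in) auto
  have inj: "inj_on \<tau> S" for S
    using permutes_inj[OF \<tau>] by (rule inj_on_subset) auto
  have "esym_factor N d \<phi> =
      (\<Sum>S\<in>(`) \<tau> ` Pow {1..N-1}. (- 1) ^ card S * d (card S) * (\<Prod>m\<in>S. cis (\<phi> m - \<phi> N)))"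
    unfolding esym_factor_def image_Pow_surj[OF permutes_image[OF \<tau>]] ..
  also have "\<dots> = (\<Sum>S\<in>Pow {1..N-1}. (- 1) ^ card S * d (card S) * (\<Prod>m\<in>S. cis (\<phi> (\<tau> m) - \<phi> N)))"
    using inj_on_image_Pow[OF inj] by (subst sum.reindex) (simp_all add: card_image[OF inj] prod.reindex[OF inj])
  finally show ?thesis
    by (simp add: esym_factor_def N)
qed

lemma tcoeff_esym_factor:
  assumes F: "bmeas N F"
  shows "tcoeff N \<alpha> (\<lambda>\<phi>. F \<phi> * esym_factor N d \<phi>) =
    (\<Sum>S\<in>Pow {1..N-1}. (- 1) ^ card S * d (card S) * tcoeff N (\<alpha> - strip_vec N S) F)"
proof -
  have "tcoeff N \<alpha> (\<lambda>\<phi>. F \<phi> * esym_factor N d \<phi>) =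
     tcoeff N \<alpha> (\<lambda>\<phi>. \<Sum>S\<in>Pow {1..N-1}. ((- 1) ^ card S * d (card S)) * (F \<phi> * tmono N (strip_vec N S) \<phi>))"
    unfolding esym_factor_eq sum_distrib_left by (simp only: mult.assoc mult.left_commute)
  then show ?thesis
    by (subst (asm) tcoeff_sum) (auto intro!: bmeas_intros F simp only: tcoeff_cmult tcoeff_shift)
qed

text \<open>The factor is symmetric in the first \<open>N - 1\<close> variables, and subtracting
  \<open>strip_vec\<close> only lowers exponents there, so a negative one stays negative.\<close>

lemma admissible_esym_factor:
  assumes F: "admissible N F"
  shows "admissible N (\<lambda>\<phi>. F \<phi> * esym_factor N d \<phi>)"
  unfolding admissible_def
proof (intro conjI allI impI)
  show "bmeas N (\<lambda>\<phi>. F \<phi> * esym_factor N d \<phi>)"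
    using F by (intro bmeas_mult bmeas_esym_factor) (simp add: admissible_def)
next
  fix \<tau> :: "nat \<Rightarrow> nat" and \<phi> assume "\<tau> permutes {1..N-1}"
  then show "F (\<phi> \<circ> \<tau>) * esym_factor N d (\<phi> \<circ> \<tau>) = of_int (sign \<tau>) * (F \<phi> * esym_factor N d \<phi>)"
    using F esym_factor_permute[of \<tau> N] by (simp add: admissible_def)
next
  fix \<alpha> :: "nat \<Rightarrow> int" assume "\<exists>m\<in>{1..N-1}. \<alpha> m < 0"
  then obtain m where m: "m \<in> {1..N-1}" "\<alpha> m < 0"
    by auto
  have "tcoeff N (\<alpha> - strip_vec N S) F = 0" for S
  proof -
    have "(\<alpha> - strip_vec N S) m < 0"
      using m by (auto simp: strip_vec_def)
    then show ?thesis
      by (rule admissible_vanish[OF F m(1)])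
  qed
  then show "tcoeff N \<alpha> (\<lambda>\<phi>. F \<phi> * esym_factor N d \<phi>) = 0"
    using F by (subst tcoeff_esym_factor) (simp_all add: admissible_def)
qed

text \<open>The exponents \<open>0, \<dots>, N - 1\<close> with \<open>p\<close> left out, in increasing order on the first \<open>N - 1\<close>
  variables, and \<open>p\<close> on the last variable.\<close>

definition hole :: "nat \<Rightarrow> nat \<Rightarrow> nat \<Rightarrow> int" where
  "hole N p m = (if m \<le> p then int m - 1 else if m < N then int m else int p)"

text \<open>Downward induction from \<open>p = N - 1\<close>, where the exponents are in natural
  order: lowering \<open>p\<close> by one exchanges the entries at \<open>Suc p\<close> and
  \<open>N\<close>, at the cost of one sign.\<close>

lemma hole_permutation:
  assumes "p < N"
  shows "\<exists>c. c permutes {1..N} \<and> sign c = (- 1) ^ (N - 1 - p) \<and> (\<forall>m\<in>{1..N}. hole N p m = int (c m) - 1)"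
  using assms
proof (induction "N - 1 - p" arbitrary: p)
  case 0
  then have "p = N - 1" by simp
  then show ?case
    using 0 by (intro exI[of _ id] conjI permutes_id) (auto simp: sign_id hole_def)
next
  case (Suc r)
  then have r: "r = N - 1 - Suc p" "Suc p < N" by auto
  then obtain c where c: "c permutes {1..N}" "sign c = (- 1) ^ (N - 1 - Suc p)"
    "\<And>m. m \<in> {1..N} \<Longrightarrow> hole N (Suc p) m = int (c m) - 1"
    using Suc.hyps(1)[of "Suc p"] by blast
  let ?t = "Transposition.transpose (Suc p) N"
  have t: "?t permutes {1..N}"
    using r by (intro permutes_swap_id) auto
  have "sign (c \<circ> ?t) = sign c * sign ?t"
    using c t by (intro sign_compose) (auto intro: permutation_permutes[THEN iffD2])
  also have "\<dots> = (- 1) ^ Suc (N - 1 - Suc p)"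
    using r c(2) by (simp add: sign_swap_id)
  also have "Suc (N - 1 - Suc p) = N - 1 - p"
    using r by simp
  finally have "sign (c \<circ> ?t) = (- 1) ^ (N - 1 - p)" .
  moreover have "hole N p m = int ((c \<circ> ?t) m) - 1" if m: "m \<in> {1..N}" for m
  proof -
    have "?t m \<in> {1..N}"
      using m permutes_in_image[OF t] by simp
    then have "int ((c \<circ> ?t) m) - 1 = hole N (Suc p) (?t m)"
      using c(3) by simp
    also have "\<dots> = hole N p m"
      using r m by (auto simp: hole_def Transposition.transpose_def)
    finally show ?thesis ..
  qed
  ultimately show ?case
    using permutes_compose[OF t c(1)] by blast
qed

lemma tcoeff_hole_weyl_alternant:
  assumes "p < N"
  shows "tcoeff N (hole N p) (weyl_alternant N) = (- 1) ^ (N - 1 - p)"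
  using hole_permutation[OF assms] tcoeff_weyl_alternant_permutation[of _ N "hole N p"] by auto

text \<open>Walking down through predecessors inside \<open>S\<close> must stop, as 0 is not in
  \<open>S\<close>, and can stop only at \<open>Suc p\<close>. The empty set is the case
  \<open>s = 0\<close>.\<close>

lemma interval_if_pred_closed:
  fixes S :: "nat set"
  assumes "finite S" "0 \<notin> S" and closed: "\<And>m. m \<in> S \<Longrightarrow> m = Suc p \<or> m - 1 \<in> S"
  obtains s where "S = {Suc p..p + s}"
proof -
  have *: "m \<in> S \<Longrightarrow> p < m \<and> {Suc p..m} \<subseteq> S" for m
  proof (induction m)
    case (Suc m)
    with closed[of "Suc m"] show ?case
      by (cases "m = p") (auto simp: le_Suc_eq)
  qed (use \<open>0 \<notin> S\<close> in simp)
  show thesis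
  proof (cases "S = {}")
    case True
    then show thesis using that[of 0] by simp
  next
    case False
    with \<open>finite S\<close> have "Max S \<in> S" "\<And>m. m \<in> S \<Longrightarrow> m \<le> Max S" by auto
    with *[of "Max S"] * have "S = {Suc p..Max S}" "p < Max S" by (auto simp: Suc_le_eq)
    then show thesis using that[of "Max S - p"] by simp
  qed
qed

text \<open>Lowering the first \<open>N - 1\<close> exponents by one on a set \<open>S\<close> creates a repeated or a negative
  exponent unless \<open>S\<close> consists of the positions directly above the hole, in which case the hole
  moves up by \<open>card S\<close>.\<close>

lemma pieri_hole:
  assumes F: "admissible N F" and p: "p < N"
  shows "tcoeff N (hole N p) (\<lambda>\<phi>. F \<phi> * esym_factor N d \<phi>) =
    (\<Sum>s\<le>N-1-p. (- 1) ^ s * d s * tcoeff N (hole N (p + s)) F)"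
proof -
  define I where "I s = {Suc p..p + s}" for s
  define f where "f S = (- 1) ^ card S * d (card S) * tcoeff N (hole N p - strip_vec N S) F" for S
  have card_I: "card (I s) = s" for s
    by (simp add: I_def)
  have "tcoeff N (hole N p) (\<lambda>\<phi>. F \<phi> * esym_factor N d \<phi>) = (\<Sum>S\<in>Pow {1..N-1}. f S)"
    using F by (simp add: tcoeff_esym_factor admissible_def f_def)
  also have "\<dots> = (\<Sum>S\<in>I ` {..N-1-p}. f S)"
  proof (rule sum.mono_neutral_right)
    show "I ` {..N-1-p} \<subseteq> Pow {1..N-1}"
      using p by (auto simp: I_def)
    show "\<forall>S\<in>Pow {1..N-1} - I ` {..N-1-p}. f S = 0"
    proof
      fix S assume S: "S \<in> Pow {1..N-1} - I ` {..N-1-p}"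
      have "\<exists>m\<in>S. m \<noteq> Suc p \<and> m - 1 \<notin> S"
      proof (rule ccontr)
        assume "\<not> (\<exists>m\<in>S. m \<noteq> Suc p \<and> m - 1 \<notin> S)"
        moreover have "finite S" "0 \<notin> S"
          using S finite_subset[of S "{1..N-1}"] by auto
        ultimately obtain s where s: "S = I s"
          unfolding I_def by (elim interval_if_pred_closed[of S p]) blast+
        moreover have "s \<le> N - 1 - p"
        proof (cases "s = 0")
          case False
          then have "p + s \<in> S" by (simp add: s I_def)
          then have "p + s \<in> {1..N-1}" using S by blast
          then show ?thesis by auto
        qed simp
        ultimately show False using S by auto
      qed
      then obtain m where m: "m \<in> S" "m \<noteq> Suc p" "m - 1 \<notin> S"
        by blast
      with S have m1: "m \<in> {1..N-1}" by auto
      \<comment> \<open>At \<open>m = 1\<close> the exponent 0 drops to -1. Otherwise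
        \<open>m - 1\<close> and \<open>m\<close> carry consecutive exponents, since
        \<open>m\<close> is not the position just above the hole, and lowering only the one at
        \<open>m\<close> makes them equal.\<close>
      have "tcoeff N (hole N p - strip_vec N S) F = 0"
      proof (cases "m = 1")
        case True
        then have "(hole N p - strip_vec N S) m < 0"
          using m m1 p by (auto simp: hole_def strip_vec_def)
        then show ?thesis
          by (rule admissible_vanish[OF F m1])
      next
        case False
        then have "m - 1 \<in> {1..N-1}" "m - 1 \<noteq> m"
          using m1 by auto
        moreover have "(hole N p - strip_vec N S) (m - 1) = (hole N p - strip_vec N S) m"
          using m m1 p False by (auto simp: hole_def strip_vec_def)
        ultimately show ?thesis
          using m1 by (intro tcoeff_antisym_eq_0[OF F, of "m - 1" m])
      qed
      then show "f S = 0" by (simp add: f_def)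
    qed
  qed simp
  also have "\<dots> = (\<Sum>s\<le>N-1-p. f (I s))"
    by (subst sum.reindex) (auto intro!: inj_onI dest: arg_cong[where f = card] simp: card_I)
  also have "\<dots> = (\<Sum>s\<le>N-1-p. (- 1) ^ s * d s * tcoeff N (hole N (p + s)) F)"
  proof (rule sum.cong[OF refl])
    fix s assume "s \<in> {..N-1-p}"
    \<comment> \<open>The exponents p+1, ..., p+s on these positions drop to p, ..., p+s-1, while
      the last exponent rises from p to p+s.\<close>
    then have "tcoeff N (hole N p - strip_vec N (I s)) F = tcoeff N (hole N (p + s)) F"
      using p by (intro tcoeff_cong) (auto simp: hole_def strip_vec_def I_def)
    then show "f (I s) = (- 1) ^ s * d s * tcoeff N (hole N (p + s)) F"
      by (simp add: f_def card_I)
  qed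
  finally show ?thesis .
qed

text \<open>Induction by \<open>pieri_hole\<close>: the sign (-1)^s completes the sign for the hole
  \<open>p + s\<close> to that for \<open>p\<close>, leaving the recursion of
  \<open>iter_conv\<close> at \<open>N - 1 - p\<close>. Admissibility is carried along to allow the
  next step.\<close>

lemma tcoeff_hole_prod:
  "admissible N (\<lambda>\<phi>. weyl_alternant N \<phi> * (\<Prod>j=1..k. esym_factor N (d j) \<phi>)) \<and>
   (\<forall>p<N. tcoeff N (hole N p) (\<lambda>\<phi>. weyl_alternant N \<phi> * (\<Prod>j=1..k. esym_factor N (d j) \<phi>)) =
      (- 1) ^ (N - 1 - p) * iter_conv d k (N - 1 - p))"
proof (induction k)
  case 0
  show ?case
    using admissible_weyl_alternant tcoeff_hole_weyl_alternant by simp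
next
  case (Suc k)
  define F where "F = (\<lambda>\<phi>. weyl_alternant N \<phi> * (\<Prod>j=1..k. esym_factor N (d j) \<phi>))"
  have F: "admissible N F" and IH: "\<And>p. p < N \<Longrightarrow> tcoeff N (hole N p) F = (- 1) ^ (N - 1 - p) * iter_conv d k (N - 1 - p)"
    using Suc by (auto simp: F_def)
  have eq: "(\<lambda>\<phi>. weyl_alternant N \<phi> * (\<Prod>j=1..Suc k. esym_factor N (d j) \<phi>)) =
      (\<lambda>\<phi>. F \<phi> * esym_factor N (d (Suc k)) \<phi>)"
    by (simp add: F_def mult.assoc)
  have "tcoeff N (hole N p) (\<lambda>\<phi>. F \<phi> * esym_factor N (d (Suc k)) \<phi>) =
      (- 1) ^ (N - 1 - p) * iter_conv d (Suc k) (N - 1 - p)" if p: "p < N" for p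
  proof -
    have "tcoeff N (hole N p) (\<lambda>\<phi>. F \<phi> * esym_factor N (d (Suc k)) \<phi>) =
        (\<Sum>s\<le>N-1-p. (- 1) ^ s * d (Suc k) s * ((- 1) ^ (N - 1 - (p + s)) * iter_conv d k (N - 1 - (p + s))))"
      unfolding pieri_hole[OF F p] using p by (intro sum.cong refl) (subst IH, auto)
    also have "\<dots> = (\<Sum>s\<le>N-1-p. (- 1) ^ (N - 1 - p) * (d (Suc k) s * iter_conv d k (N - 1 - p - s)))"
    proof (rule sum.cong[OF refl])
      fix s assume s: "s \<in> {..N-1-p}"
      then have "(- 1 :: complex) ^ (N - 1 - p) = (- 1) ^ s * (- 1) ^ (N - 1 - (p + s))"
        using p by (subst power_add [symmetric], intro arg_cong[where f = "(^) (- 1)"]) auto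
      then show "(- 1) ^ s * d (Suc k) s * ((- 1) ^ (N - 1 - (p + s)) * iter_conv d k (N - 1 - (p + s))) =
          (- 1) ^ (N - 1 - p) * (d (Suc k) s * iter_conv d k (N - 1 - p - s))"
        by (simp add: diff_diff_eq)
    qed
    finally show ?thesis
      by (simp add: sum_distrib_left)
  qed
  with admissible_esym_factor[OF F] show ?case
    unfolding eq by blast
qed

section \<open>Pairing with the conjugate alternant\<close>

text \<open>Each Leibniz term of the conjugate extracts the coefficient with exponents
  \<open>\<sigma> m - 1\<close>. The (N - 1)! terms with the same \<open>\<sigma> N = p + 1\<close>
  agree by antisymmetry and are represented by \<open>hole N p\<close>.\<close>

lemma integral_cnj_weyl_alternant:
  assumes G: "admissible N G" and N: "N > 0"
  shows "(\<integral>\<phi>. cnj (weyl_alternant N \<phi>) * G \<phi> \<partial>torus N) =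
    of_real ((2 * pi) ^ N) * (fact (N - 1) * (\<Sum>p<N. (- 1) ^ (N - 1 - p) * tcoeff N (hole N p) G))"
proof -
  have bG: "bmeas N G" using G by (simp add: admissible_def)
  let ?e = "\<lambda>\<sigma> m. int (\<sigma> m) - 1"
  define f where "f \<sigma> = of_int (sign \<sigma>) * tcoeff N (?e \<sigma>) G" for \<sigma>
  have cnj_tmono: "cnj (tmono N \<alpha> \<phi>) = tmono N (- \<alpha>) \<phi>" for \<alpha> \<phi>
    by (simp add: tmono_def cis_cnj)
  have "(\<integral>\<phi>. cnj (weyl_alternant N \<phi>) * G \<phi> \<partial>torus N) =
      (\<integral>\<phi>. (\<Sum>\<sigma> | \<sigma> permutes {1..N}. of_int (sign \<sigma>) * (G \<phi> * tmono N (- ?e \<sigma>) \<phi>)) \<partial>torus N)"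
    unfolding weyl_alternant_eq cnj_sum sum_distrib_right by (simp add: cnj_tmono mult_ac)
  also have "\<dots> = (\<Sum>\<sigma> | \<sigma> permutes {1..N}. of_int (sign \<sigma>) * (\<integral>\<phi>. G \<phi> * tmono N (- ?e \<sigma>) \<phi> \<partial>torus N))"
    by (subst Bochner_Integration.integral_sum) (auto intro!: bmeas_integrable bmeas_intros bG)
  also have "\<dots> = of_real ((2 * pi) ^ N) * (\<Sum>\<sigma> | \<sigma> permutes {1..N}. f \<sigma>)"
    unfolding f_def tcoeff_def sum_distrib_left by (intro sum.cong) simp_all
  \<comment> \<open>Permutations are grouped by their value \<open>b\<close> at
    \<open>N\<close>.\<close>
  also have "(\<Sum>\<sigma> | \<sigma> permutes {1..N}. f \<sigma>) =
      (\<Sum>b\<in>{1..N}. \<Sum>q | q permutes {1..N-1}. f (Transposition.transpose N b \<circ> q))"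
  proof -
    have "{1..N} = insert N {1..N-1}" using N by auto
    then show ?thesis
      using N sum_over_permutations_insert[of "{1..N-1}" N f] by simp
  qed
  also have "\<dots> = (\<Sum>b\<in>{1..N}. fact (N - 1) * ((- 1) ^ (N - 1 - (b - 1)) * tcoeff N (hole N (b - 1)) G))"
  proof (rule sum.cong[OF refl])
    fix b assume b: "b \<in> {1..N}"
    let ?t = "Transposition.transpose N b"
    have t: "?t permutes {1..N}"
      using b by (intro permutes_swap_id) auto
    obtain c where c: "c permutes {1..N}" "sign c = (- 1) ^ (N - 1 - (b - 1))"
      "\<forall>m\<in>{1..N}. hole N (b - 1) m = int (c m) - 1"
    proof -
      have "b - 1 < N" using b by auto
      from hole_permutation[OF this] show thesis
        using that by blast
    qed
    have "c N = b"
      using bspec[OF c(3), of N] b N by (auto simp: hole_def split: if_splits)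
    have f_compose: "f (?t \<circ> q) = (- 1) ^ (N - 1 - (b - 1)) * tcoeff N (hole N (b - 1)) G" if q: "q permutes {1..N-1}" for q
    proof -
      \<comment> \<open>Both \<open>c\<close> and \<open>?t \<circ> q\<close> send \<open>N\<close>
        to \<open>b\<close>, so \<tau> fixes \<open>N\<close> and permutes the first
        \<open>N - 1\<close> indices.\<close>
      define \<tau> where "\<tau> = inv c \<circ> (?t \<circ> q)"
      have tq: "?t \<circ> q permutes {1..N}"
        using permutes_compose[OF permutes_pred[OF q] t] .
      have "\<tau> permutes {1..N}"
        unfolding \<tau>_def using permutes_compose[OF tq permutes_inv[OF c(1)]] .
      moreover have "q N = N"
        using q by (rule permutes_not_in) (use N in auto)
      then have "\<tau> N = N"
        using \<open>c N = b\<close> permutes_inverses(2)[OF c(1), of N] by (simp add: \<tau>_def)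
      ultimately have \<tau>: "\<tau> permutes {1..N-1}"
        by (rule_tac permutes_superset) (auto simp: le_less)
      have eq: "?t \<circ> q = c \<circ> \<tau>"
        using permutes_inverses(1)[OF c(1)] by (auto simp: \<tau>_def fun_eq_iff)
      have sgn: "sign (c \<circ> \<tau>) = sign c * sign \<tau>"
        using c(1) permutes_pred[OF \<tau>] by (intro sign_compose) (auto intro: permutation_permutes[THEN iffD2])
      have "tcoeff N (?e (c \<circ> \<tau>)) G = tcoeff N (?e c \<circ> \<tau>) G"
        by (simp add: o_def)
      also have "\<dots> = of_int (sign \<tau>) * tcoeff N (?e c) G"
        by (rule tcoeff_antisym[OF G \<tau>])
      also have "tcoeff N (?e c) G = tcoeff N (hole N (b - 1)) G"
        using c(3) by (intro tcoeff_cong) auto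
      \<comment> \<open>One sign of \<tau> stems from the Leibniz term and one from antisymmetry, so
        they cancel.\<close>
      finally have "f (c \<circ> \<tau>) = of_int (sign c) * (of_int (sign \<tau>) * of_int (sign \<tau>)) * tcoeff N (hole N (b - 1)) G"
        by (simp add: f_def sgn)
      also have "(of_int (sign \<tau>) * of_int (sign \<tau>) :: complex) = 1"
        unfolding of_int_mult [symmetric] by (simp only: sign_idempotent of_int_1)
      finally show ?thesis
        unfolding eq c(2) by (simp only: mult_1_right of_int_power of_int_minus of_int_1)
    qed
    have "(\<Sum>q | q permutes {1..N-1}. f (?t \<circ> q)) =
        (\<Sum>q | q permutes {1..N-1}. (- 1) ^ (N - 1 - (b - 1)) * tcoeff N (hole N (b - 1)) G)"
      by (rule sum.cong[OF refl]) (simp only: mem_Collect_eq f_compose)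
    also have "card {q. q permutes {1..N-1}} = fact (N - 1)"
      by (intro card_permutations) auto
    then have "(\<Sum>q | q permutes {1..N-1}. (- 1) ^ (N - 1 - (b - 1)) * tcoeff N (hole N (b - 1)) G) =
       fact (N - 1) * ((- 1) ^ (N - 1 - (b - 1)) * tcoeff N (hole N (b - 1)) G)"
      by simp
    finally show "(\<Sum>q | q permutes {1..N-1}. f (?t \<circ> q)) =
      fact (N - 1) * ((- 1) ^ (N - 1 - (b - 1)) * tcoeff N (hole N (b - 1)) G)" .
  qed
  also have "\<dots> = (\<Sum>p<N. fact (N - 1) * ((- 1) ^ (N - 1 - p) * tcoeff N (hole N p) G))"
    by (rule sum.reindex_bij_witness[where i = Suc and j = "\<lambda>b. b - 1"]) auto
  finally show ?thesis
    by (simp add: sum_distrib_left)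
qed

text \<open>The signs from the pairing and from the coefficients cancel, and
  \<open>r = N - 1 - p\<close> reverses the sum.\<close>

lemma integral_weyl_alternant_esym_factors:
  assumes N: "N > 0"
  shows "(\<integral>\<phi>. cnj (weyl_alternant N \<phi>) * (weyl_alternant N \<phi> * (\<Prod>j=1..k. esym_factor N (d j) \<phi>)) \<partial>torus N) =
    of_real ((2 * pi) ^ N) * fact (N - 1) * (\<Sum>r<N. iter_conv d k r)"
proof -
  define G where "G = (\<lambda>\<phi>. weyl_alternant N \<phi> * (\<Prod>j=1..k. esym_factor N (d j) \<phi>))"
  have "admissible N G" and G: "\<And>p. p < N \<Longrightarrow> tcoeff N (hole N p) G = (- 1) ^ (N - 1 - p) * iter_conv d k (N - 1 - p)"
    using tcoeff_hole_prod[where N = N and k = k and d = d] by (auto simp: G_def)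
  then have "(\<integral>\<phi>. cnj (weyl_alternant N \<phi>) * G \<phi> \<partial>torus N) =
      of_real ((2 * pi) ^ N) * (fact (N - 1) * (\<Sum>p<N. (- 1) ^ (N - 1 - p) * ((- 1) ^ (N - 1 - p) * iter_conv d k (N - 1 - p))))"
    using integral_cnj_weyl_alternant[OF _ N, of G] by simp
  also have "(\<Sum>p<N. (- 1) ^ (N - 1 - p) * ((- 1) ^ (N - 1 - p) * iter_conv d k (N - 1 - p))) =
      (\<Sum>p<N. iter_conv d k (N - 1 - p))"
    by (intro sum.cong refl) (simp add: mult.assoc [symmetric] power_add [symmetric] mult_2 [symmetric])
  also have "\<dots> = (\<Sum>r<N. iter_conv d k r)"
    by (rule sum.reindex_bij_witness[where i = "\<lambda>p. N - 1 - p" and j = "\<lambda>p. N - 1 - p"]) auto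
  finally show ?thesis
    unfolding G_def by (simp add: mult.assoc)
qed

section \<open>The characteristic polynomial\<close>

text \<open>\<open>S\<close> records the factors whose second term is chosen. The result is a
  trigonometric polynomial in \<open>t\<close>, ready for termwise differentiation.\<close>

lemma charpoly_Z_expand:
  "charpoly_Z N \<phi> t =
     (\<Sum>S\<in>Pow {1..N}. ((- 1) ^ card S * (\<Prod>m\<in>S. cis (\<phi> m))) * cis (- (real (card S) * t)))"
proof -
  have "charpoly_Z N \<phi> t = (\<Prod>m\<in>{1..N}. (- 1) * cis (\<phi> m) * cis (- t) + 1)"
    by (simp add: charpoly_Z_def)
  also have "\<dots> = (\<Sum>S\<in>Pow {1..N}. (\<Prod>m\<in>S. (- 1) * cis (\<phi> m) * cis (- t)))"
    by (subst prod_add) simp_all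
  also have "\<dots> = (\<Sum>S\<in>Pow {1..N}. ((- 1) ^ card S * (\<Prod>m\<in>S. cis (\<phi> m))) * cis (- (real (card S) * t)))"
    unfolding prod.distrib using Complex.DeMoivre[of "- t"] by simp
  finally show ?thesis .
qed

lemma nth_deriv_trig_sum:
  "nth_deriv n (\<lambda>t. \<Sum>i\<in>A. c i * cis (- (real (a i) * t))) =
     (\<lambda>t. \<Sum>i\<in>A. c i * (- \<i> * of_nat (a i)) ^ n * cis (- (real (a i) * t)))"
proof (induction n)
  case 0
  show ?case by (simp add: nth_deriv_def)
next
  case (Suc n)
  have "((\<lambda>t. \<Sum>i\<in>A. c i * (- \<i> * of_nat (a i)) ^ n * cis (- (real (a i) * t))) has_vector_derivative
      (\<Sum>i\<in>A. c i * (- \<i> * of_nat (a i)) ^ Suc n * cis (- (real (a i) * t)))) (at t)" for t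
  proof (rule has_vector_derivative_sum)
    fix i
    have "((\<lambda>t. cis (- (real (a i) * t))) has_vector_derivative (- \<i> * of_nat (a i)) * cis (- (real (a i) * t))) (at t)"
      unfolding cis_conv_exp
      by (auto intro!: derivative_eq_intros has_vector_derivative_real_field)
    from has_vector_derivative_mult_right[OF this, of "c i * (- \<i> * of_nat (a i)) ^ n"]
    show "((\<lambda>t. c i * (- \<i> * of_nat (a i)) ^ n * cis (- (real (a i) * t))) has_vector_derivative
        c i * (- \<i> * of_nat (a i)) ^ Suc n * cis (- (real (a i) * t))) (at t)"
      by (simp add: mult_ac)
  qed
  then have "vector_derivative (\<lambda>t. \<Sum>i\<in>A. c i * (- \<i> * of_nat (a i)) ^ n * cis (- (real (a i) * t))) (at t) =
      (\<Sum>i\<in>A. c i * (- \<i> * of_nat (a i)) ^ Suc n * cis (- (real (a i) * t)))" for t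
    by (rule vector_derivative_at)
  with Suc show ?case
    by (simp add: nth_deriv_def)
qed

lemma nth_deriv_charpoly_Z:
  "nth_deriv n (charpoly_Z N \<phi>) t =
     (\<Sum>S\<in>Pow {1..N}. ((- 1) ^ card S * (\<Prod>m\<in>S. cis (\<phi> m))) * (- \<i> * of_nat (card S)) ^ n * cis (- (real (card S) * t)))"
  unfolding charpoly_Z_expand [abs_def] nth_deriv_trig_sum ..

text \<open>At \<open>\<phi> N\<close> the index \<open>N\<close> contributes the factor
  \<open>cis 0 = 1\<close>, so the terms of \<open>S\<close> and \<open>insert N S\<close> differ
  only in sign and in the power of the size, \<open>card S\<close> against
  \<open>card S + 1\<close>. Pairing them leaves the increment of the n-th power.\<close>

lemma nth_deriv_charpoly_Z_last:
  assumes "N > 0"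
  shows "nth_deriv n (charpoly_Z N \<phi>) (\<phi> N) =
    esym_factor N (\<lambda>s. - ((- \<i>) ^ n) * of_real ((real s + 1) ^ n - real s ^ n)) \<phi>"
proof -
  define f where "f S = ((- 1) ^ card S * (- \<i> * of_nat (card S)) ^ n * (\<Prod>m\<in>S. cis (\<phi> m - \<phi> N)))" for S
  have "nth_deriv n (charpoly_Z N \<phi>) (\<phi> N) = (\<Sum>S\<in>Pow {1..N}. f S)"
    unfolding nth_deriv_charpoly_Z f_def
  proof (rule sum.cong[OF refl])
    fix S :: "nat set"
    have "(\<Prod>m\<in>S. cis (\<phi> m - \<phi> N)) = (\<Prod>m\<in>S. cis (\<phi> m) * cis (- \<phi> N))"
      by (simp only: cis_mult) simp
    also have "\<dots> = (\<Prod>m\<in>S. cis (\<phi> m)) * cis (- (real (card S) * \<phi> N))"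
      unfolding prod.distrib using Complex.DeMoivre[of "- \<phi> N" "card S"] by simp
    finally show "((- 1) ^ card S * (\<Prod>m\<in>S. cis (\<phi> m))) * (- \<i> * of_nat (card S)) ^ n * cis (- (real (card S) * \<phi> N)) =
        (- 1) ^ card S * (- \<i> * of_nat (card S)) ^ n * (\<Prod>m\<in>S. cis (\<phi> m - \<phi> N))"
      by simp
  qed
  also have "{1..N} = insert N {1..N-1}"
    using assms by auto
  also have "(\<Sum>S\<in>Pow (insert N {1..N-1}). f S) = (\<Sum>S\<in>Pow {1..N-1}. f S) + (\<Sum>S\<in>insert N ` Pow {1..N-1}. f S)"
    unfolding Pow_insert using assms by (intro sum.union_disjoint) auto
  also have "(\<Sum>S\<in>insert N ` Pow {1..N-1}. f S) = (\<Sum>S\<in>Pow {1..N-1}. f (insert N S))"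
  proof (rule sum.reindex_cong[OF _ refl refl])
    show "inj_on (insert N) (Pow {1..N-1})"
    proof (rule inj_onI)
      fix S T assume ST: "S \<in> Pow {1..N-1}" "T \<in> Pow {1..N-1}" "insert N S = insert N T"
      moreover have "N \<notin> {1..N-1}" using assms by auto
      ultimately have "N \<notin> S" "N \<notin> T" by blast+
      with ST(3) show "S = T" by (simp add: insert_ident)
    qed
  qed
  also have "(\<Sum>S\<in>Pow {1..N-1}. f S) + (\<Sum>S\<in>Pow {1..N-1}. f (insert N S)) =
      esym_factor N (\<lambda>s. - ((- \<i>) ^ n) * of_real ((real s + 1) ^ n - real s ^ n)) \<phi>"
    unfolding esym_factor_def sum.distrib [symmetric]
  proof (rule sum.cong[OF refl])
    fix S assume S: "S \<in> Pow {1..N-1}"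
    have NS: "N \<notin> S" and fin: "finite S"
      using S assms finite_subset[of S "{1..N-1}"] by auto
    have "f (insert N S) = (- 1) ^ Suc (card S) * (- \<i> * of_nat (Suc (card S))) ^ n * (\<Prod>m\<in>S. cis (\<phi> m - \<phi> N))"
      using NS fin by (simp add: f_def)
    then have "f S + f (insert N S) = (- 1) ^ card S *
        ((- \<i> * of_nat (card S)) ^ n - (- \<i> * of_nat (Suc (card S))) ^ n) * (\<Prod>m\<in>S. cis (\<phi> m - \<phi> N))"
      by (simp add: f_def algebra_simps)
    also have "(- \<i> * of_nat (card S)) ^ n - (- \<i> * of_nat (Suc (card S))) ^ n =
        - ((- \<i>) ^ n) * of_real ((real (card S) + 1) ^ n - real (card S) ^ n)"
      unfolding power_mult_distrib by (simp add: algebra_simps)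
    finally show "f S + f (insert N S) = (- 1) ^ card S *
        (- ((- \<i>) ^ n) * of_real ((real (card S) + 1) ^ n - real (card S) ^ n)) * (\<Prod>m\<in>S. cis (\<phi> m - \<phi> N))" .
  qed
  finally show ?thesis .
qed

section \<open>Exact evaluation of the expectation\<close>

lemma bmeas_nth_deriv_charpoly_Z:
  assumes "m \<in> {1..N}"
  shows "bmeas N (\<lambda>\<phi>. nth_deriv n (charpoly_Z N \<phi>) (\<phi> m))"
proof -
  have "bmeas N (\<lambda>\<phi>. cis (\<phi> i))" if "i \<in> {1..N}" for i
    using bmeas_cis[OF that, of 1] by simp
  moreover have "bmeas N (\<lambda>\<phi>. cis (- (x * \<phi> m)))" for x
    using bmeas_cis[OF assms, of "- x"] by simp
  ultimately show ?thesis
    unfolding nth_deriv_charpoly_Z by (intro bmeas_intros) auto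
qed

lemma bmeas_cnj: "bmeas N F \<Longrightarrow> bmeas N (\<lambda>\<phi>. cnj (F \<phi>))"
  by (auto simp: bmeas_def borel_measurable_complex_iff)

lemma charpoly_Z_permute:
  assumes \<tau>: "\<tau> permutes {1..N}"
  shows "charpoly_Z N (\<phi> \<circ> \<tau>) = charpoly_Z N \<phi>"
  unfolding charpoly_Z_def
  using prod.permute[OF \<tau>, of "\<lambda>m. 1 - cis (\<phi> m) * cis (- t)" for t] by (simp add: o_def)

text \<open>The product of differences is the alternant by \<open>vandermonde_alternant\<close>. Its
  squared modulus is split with a conjugate so that the two alternants can be treated
  differently.\<close>

lemma weyl_density_eq:
  "of_real (weyl_density N \<phi>) =
     cnj (weyl_alternant N \<phi>) * weyl_alternant N \<phi> / of_real (fact N * (2 * pi) ^ N)"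
proof -
  have W: "weyl_alternant N \<phi> = (\<Prod>l=1..N. \<Prod>j=1..<l. cis (\<phi> l) - cis (\<phi> j))"
    unfolding weyl_alternant_def vandermonde_alternant [symmetric] ..
  have "(\<Prod>l=1..N. \<Prod>j=1..<l. (cmod (cis (\<phi> j) - cis (\<phi> l)))\<^sup>2) = (cmod (weyl_alternant N \<phi>))\<^sup>2"
    unfolding W by (simp only: prod_norm [symmetric] prod_power_distrib norm_minus_commute)
  moreover have "of_real ((cmod (weyl_alternant N \<phi>))\<^sup>2) = cnj (weyl_alternant N \<phi>) * weyl_alternant N \<phi>"
    by (simp only: complex_norm_square mult.commute)
  ultimately show ?thesis
    unfolding weyl_density_def by simp
qed

text \<open>The \<open>N\<close> summands have equal integrals, which cancels the averaging factor.
  The remaining 1 / N is (N - 1)! / N!, the count from the pairing over the normalisation of the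
  density.\<close>

lemma eigenphase_expectation:
  assumes N: "N > 0"
  shows "(\<integral>\<phi>. 1 / of_nat N * (\<Sum>m=1..N. \<Prod>j=1..k. nth_deriv (n j) (charpoly_Z N \<phi>) (\<phi> m)) \<partial>eigenphase_measure N) =
    (\<Prod>j=1..k. - ((- \<i>) ^ n j)) *
    of_real ((\<Sum>r<N. iter_conv (\<lambda>j s. (real s + 1) ^ n j - real s ^ n j) k r) / real N)"
proof -
  define P where "P m \<phi> = (\<Prod>j=1..k. nth_deriv (n j) (charpoly_Z N \<phi>) (\<phi> m))" for m \<phi>
  define G where "G m \<phi> = cnj (weyl_alternant N \<phi>) * (weyl_alternant N \<phi> * P m \<phi>)" for m \<phi>
  define d where "d j s = - ((- \<i>) ^ n j) * complex_of_real ((real s + 1) ^ n j - real s ^ n j)" for j s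
  define C where "C = complex_of_real (fact N * (2 * pi) ^ N)"
  have bP: "bmeas N (P m)" if "m \<in> {1..N}" for m
    unfolding P_def [abs_def] by (intro bmeas_prod bmeas_nth_deriv_charpoly_Z that)
  have bG: "bmeas N (G m)" if "m \<in> {1..N}" for m
    unfolding G_def [abs_def] by (intro bmeas_mult bmeas_cnj bmeas_weyl_alternant bP that)
  have "bmeas N (\<lambda>\<phi>. complex_of_real (weyl_density N \<phi>))"
    unfolding weyl_density_eq divide_inverse
    by (intro bmeas_mult bmeas_cnj bmeas_weyl_alternant bmeas_const)
  then have wd: "weyl_density N \<in> borel_measurable (torus N)"
    by (simp add: bmeas_def borel_measurable_complex_iff)
  have wd_nonneg: "weyl_density N \<phi> \<ge> 0" for \<phi>
    unfolding weyl_density_def by (intro mult_nonneg_nonneg divide_nonneg_nonneg prod_nonneg) auto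
  have "(\<integral>\<phi>. 1 / of_nat N * (\<Sum>m=1..N. P m \<phi>) \<partial>eigenphase_measure N) =
      (\<integral>\<phi>. weyl_density N \<phi> *\<^sub>R (1 / of_nat N * (\<Sum>m=1..N. P m \<phi>)) \<partial>torus N)"
    unfolding eigenphase_measure_def torus_def [symmetric]
  proof (rule integral_density)
    have "bmeas N (\<lambda>\<phi>. 1 / of_nat N * (\<Sum>m=1..N. P m \<phi>))"
      by (intro bmeas_mult bmeas_const bmeas_sum bP)
    then show "(\<lambda>\<phi>. 1 / of_nat N * (\<Sum>m=1..N. P m \<phi>)) \<in> borel_measurable (torus N)"
      by (simp add: bmeas_def)
  qed (use wd wd_nonneg in auto)
  also have "\<dots> = (\<integral>\<phi>. inverse (C * of_nat N) * (\<Sum>m=1..N. G m \<phi>) \<partial>torus N)"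
    unfolding scaleR_conv_of_real weyl_density_eq C_def [symmetric] G_def
    by (simp add: sum_distrib_left divide_inverse mult_ac)
  also have "\<dots> = inverse (C * of_nat N) * (\<Sum>m=1..N. \<integral>\<phi>. G m \<phi> \<partial>torus N)"
    by (subst integral_mult_right_zero, subst Bochner_Integration.integral_sum) (auto intro!: bmeas_integrable bG)
  also have "(\<Sum>m=1..N. \<integral>\<phi>. G m \<phi> \<partial>torus N) = (\<Sum>m=1..N. \<integral>\<phi>. G N \<phi> \<partial>torus N)"
  proof (rule sum.cong[OF refl])
    fix m assume m: "m \<in> {1..N}"
    let ?\<tau> = "Transposition.transpose m N"
    have \<tau>: "?\<tau> permutes {1..N}"
      using m by (intro permutes_swap_id) auto
    \<comment> \<open>The alternant and its conjugate both acquire the sign of the transposition,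
      while \<open>charpoly_Z\<close> is symmetric.\<close>
    have "G m \<phi> = G N (\<phi> \<circ> ?\<tau>)" for \<phi>
    proof -
      have "(of_int (sign ?\<tau>) * of_int (sign ?\<tau>) :: complex) = 1"
        unfolding of_int_mult [symmetric] by (simp only: sign_idempotent of_int_1)
      then have "G N (\<phi> \<circ> ?\<tau>) = cnj (weyl_alternant N \<phi>) * (weyl_alternant N \<phi> * P N (\<phi> \<circ> ?\<tau>))"
        unfolding G_def weyl_alternant_permute[OF \<tau>] by simp
      also have "P N (\<phi> \<circ> ?\<tau>) = P m \<phi>"
        unfolding P_def charpoly_Z_permute[OF \<tau>] by simp
      finally show ?thesis
        unfolding G_def ..
    qed
    then show "(\<integral>\<phi>. G m \<phi> \<partial>torus N) = (\<integral>\<phi>. G N \<phi> \<partial>torus N)"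
      using integral_torus_permute[OF \<tau> bG[of N]] N by simp
  qed
  also have "(\<integral>\<phi>. G N \<phi> \<partial>torus N) =
      (\<integral>\<phi>. cnj (weyl_alternant N \<phi>) * (weyl_alternant N \<phi> * (\<Prod>j=1..k. esym_factor N (d j) \<phi>)) \<partial>torus N)"
    unfolding G_def P_def nth_deriv_charpoly_Z_last[OF N] d_def ..
  also have "\<dots> = of_real ((2 * pi) ^ N) * fact (N - 1) * (\<Sum>r<N. iter_conv d k r)"
    by (rule integral_weyl_alternant_esym_factors[OF N])
  also have "inverse (C * of_nat N) * (\<Sum>m=1..N. of_real ((2 * pi) ^ N) * fact (N - 1) * (\<Sum>r<N. iter_conv d k r)) =
      (\<Sum>r<N. iter_conv d k r) / of_nat N"
  proof -
    have "C = of_real ((2 * pi) ^ N) * (of_nat N * fact (N - 1))"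
      using N by (simp add: C_def fact_reduce)
    then show ?thesis
      using N by (simp add: field_simps)
  qed
  also have "(\<Sum>r<N. iter_conv d k r) =
      (\<Prod>j=1..k. - ((- \<i>) ^ n j)) * of_real (\<Sum>r<N. iter_conv (\<lambda>j s. (real s + 1) ^ n j - real s ^ n j) k r)"
    unfolding d_def iter_conv_cmult iter_conv_of_real of_real_sum sum_distrib_left ..
  finally show ?thesis
    unfolding P_def by simp
qed

text \<open>Adding or subtracting \<open>k\<close> in the exponent of -1 gives the same
  parity.\<close>

lemma sign_prod_eq:
  assumes "\<And>j. j \<in> {1..k} \<Longrightarrow> n j \<ge> 1"
  shows "(\<Prod>j=1..k. - ((- \<i>) ^ n j)) = (- 1) ^ ((\<Sum>j=1..k. n j) - k) * \<i> ^ (\<Sum>j=1..k. n j)"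
proof -
  \<comment> \<open>Each \<open>n j\<close> being at least 1, the truncated subtraction is a true
    one.\<close>
  have "k = (\<Sum>j=1..k. 1)" by simp
  also have "\<dots> \<le> (\<Sum>j=1..k. n j)"
    by (intro sum_mono assms)
  finally have "(\<Sum>j=1..k. n j) + k = ((\<Sum>j=1..k. n j) - k) + 2 * k"
    by simp
  then have "(- 1 :: complex) ^ (\<Sum>j=1..k. n j) * (- 1) ^ k = (- 1) ^ ((\<Sum>j=1..k. n j) - k)"
    unfolding power_add [symmetric] by (simp only: power_add power_mult) simp
  moreover have "(\<Prod>j=1..k. - ((- \<i>) ^ n j)) = (\<Prod>j=1..k. (- 1) * ((- 1) ^ n j * \<i> ^ n j))"
    unfolding power_mult_distrib [symmetric] by simp
  then have "(\<Prod>j=1..k. - ((- \<i>) ^ n j)) = (- 1) ^ k * ((- 1) ^ (\<Sum>j=1..k. n j) * \<i> ^ (\<Sum>j=1..k. n j))"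
    unfolding prod.distrib power_sum [symmetric] by simp
  ultimately show ?thesis
    by (simp add: mult_ac)
qed

theorem theorem5:
  fixes k :: nat and n :: "nat \<Rightarrow> nat"
  assumes "k \<ge> 1" and "\<And>j. j \<in> {1..k} \<Longrightarrow> n j \<ge> 1"
  shows "(\<lambda>N::nat. \<integral>\<phi>. 1 / of_nat N *
              (\<Sum>m=1..N. \<Prod>j=1..k. nth_deriv (n j) (charpoly_Z N \<phi>) (\<phi> m))
            \<partial>eigenphase_measure N)
         \<sim>[at_top]
         (\<lambda>N. (- 1) ^ ((\<Sum>j=1..k. n j) - k) * \<i> ^ (\<Sum>j=1..k. n j) *
            ((\<Prod>j=1..k. fact (n j)) / fact ((\<Sum>j=1..k. n j) + 1)) *
            of_nat N ^ (\<Sum>j=1..k. n j))"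
proof (rule asymp_equivI')
  define m where "m = (\<Sum>j=1..k. n j)"
  define c where "c = (\<Prod>j=1..k. fact (n j)) / (fact (m + 1) :: real)"
  define s where "s = (- 1 :: complex) ^ (m - k) * \<i> ^ m"
  define T where "T N = (\<Sum>r<N. iter_conv (\<lambda>j s. (real s + 1) ^ n j - real s ^ n j) k r)" for N
  have prod_eq: "(\<Prod>j=1..k. - ((- \<i>) ^ n j)) = s"
    unfolding s_def m_def by (rule sign_prod_eq[OF assms(2)])
  have nonzero: "c \<noteq> 0" "s \<noteq> 0"
    by (auto simp: c_def s_def)
  \<comment> \<open>The limit is normalised to 1 while everything is still real.\<close>
  have "(\<lambda>N. T N / real N ^ (m + 1) / c) \<longlonglongrightarrow> c / c"
    unfolding T_def c_def m_def using nonzero unfolding c_def m_def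
    by (intro tendsto_divide sum_iter_conv_limit assms tendsto_const)
  then have "(\<lambda>N. complex_of_real (T N / real N ^ (m + 1) / c)) \<longlonglongrightarrow> of_real 1"
    using nonzero by (intro tendsto_of_real) simp
  \<comment> \<open>For positive \<open>N\<close> the expectation equals \<open>s * T N / N\<close>:
    the phase \<open>s\<close> cancels and the powers of \<open>N\<close> combine to
    \<open>m + 1\<close>.\<close>
  moreover have "eventually (\<lambda>N. complex_of_real (T N / real N ^ (m + 1) / c) =
      (\<integral>\<phi>. 1 / of_nat N * (\<Sum>m=1..N. \<Prod>j=1..k. nth_deriv (n j) (charpoly_Z N \<phi>) (\<phi> m)) \<partial>eigenphase_measure N) /
      (s * of_real c * of_nat N ^ m)) sequentially"
    using eventually_gt_at_top[of 0]
  proof eventually_elim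
    case (elim N)
    then show ?case
      unfolding eigenphase_expectation[OF elim] T_def [symmetric] prod_eq
      using nonzero by simp
  qed
  ultimately have "(\<lambda>N. (\<integral>\<phi>. 1 / of_nat N * (\<Sum>m=1..N. \<Prod>j=1..k. nth_deriv (n j) (charpoly_Z N \<phi>) (\<phi> m)) \<partial>eigenphase_measure N) /
      (s * of_real c * of_nat N ^ m)) \<longlonglongrightarrow> of_real 1"
    by (rule Lim_transform_eventually)
  then show "(\<lambda>N. (\<integral>\<phi>. 1 / of_nat N * (\<Sum>m=1..N. \<Prod>j=1..k. nth_deriv (n j) (charpoly_Z N \<phi>) (\<phi> m)) \<partial>eigenphase_measure N) /
      ((- 1) ^ ((\<Sum>j=1..k. n j) - k) * \<i> ^ (\<Sum>j=1..k. n j) *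
            ((\<Prod>j=1..k. fact (n j)) / fact ((\<Sum>j=1..k. n j) + 1)) *
            of_nat N ^ (\<Sum>j=1..k. n j))) \<longlonglongrightarrow> 1"
    unfolding s_def c_def m_def by simp
qed

end
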